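(* Let $k$ be a non-Archimedean field (not necessarily complete) with valuation ring $\mathfrak{o}$ and residue field $\mathbb{F}$, and let $\phi, \psi \in k(z)$ be rational functions of degree at least $2$. Suppose that both $\phi$ and $\psi$ have good reduction. Then every element of $\mathrm{Conj}_{\phi,\psi}(k)$ has good reduction, and the canonical reduction $\mathfrak{o} \to \mathbb{F}$ induces a map of sets $\mathrm{red}_{\phi, \psi} : \mathrm{Conj}_{\phi,\psi}(k) \to \mathrm{Conj}_{\phi,\psi}(\mathbb{F})$. If the order of $\mathrm{Aut}_\phi(k)$ is relatively prime to the characteristic of $\mathbb{F}$, then $\mathrm{red}_{\phi, \psi}$ is injective.
   Context: The degree of a rational function $f/g$ with $f,g$ coprime polynomials is $\max\{\deg f,\deg g\}$. An endomorphism $\phi:\mathbb{P}^1_k\to\mathbb{P}^1_k$ has good reduction if there exists a morphism $\Phi:\mathbb{P}^1_{\mathfrak{o}}\to\mathbb{P}^1_{\mathfrak{o}}$ that agrees with $\phi$ on the generic fiber; its reduction is the restriction of $\Phi$ to $\mathbb{P}^1_{\mathbb{F}}$. This applies in particular to elements of $\mathrm{PGL}_2(k)=\mathrm{Aut}(\mathbb{P}^1_k)$. $\mathrm{Conj}_{\phi,\psi}(k)=\{f\in\mathrm{PGL}_2(k): f\circ\phi\circ f^{-1}=\psi\}$ and $\mathrm{Aut}_\phi(k)=\mathrm{Conj}_{\phi,\phi}(k)$ (a finite group when $\deg\phi\ge 2$). $\mathrm{Conj}_{\phi,\psi}(\mathbb{F})$ is the set of $f\in\mathrm{PGL}_2(\mathbb{F})$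 conjugating the reduction of $\phi$ to the reduction of $\psi$ in the same sense. *)

theory Defs
  imports "HOL-Computational_Algebra.Computational_Algebra" "HOL-Library.FuncSet"
begin

text \<open>
  Neither completeness nor non-triviality of the absolute value is assumed; the trivial absolute
  value (valuation ring the whole field) is thus allowed.
\<close>

class nonarchimedean_field = field +
  fixes absval :: "'a \<Rightarrow> real"
  assumes absval_nonneg: "absval x \<ge> 0"
    and absval_eq_0_iff: "absval x = 0 \<longleftrightarrow> x = 0"
    and absval_mult: "absval (x * y) = absval x * absval y"
    and absval_ultrametric: "absval (x + y) \<le> max (absval x) (absval y)"

lemma absval_0 [simp]: "absval (0 :: 'a :: nonarchimedean_field) = 0"
  by (simp add: absval_eq_0_iff)

lemma absval_1 [simp]: "absval (1 :: 'a :: nonarchimedean_field) = 1"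
proof -
  have "absval (1 :: 'a) * absval (1 :: 'a) = absval (1 :: 'a)"
    using absval_mult[of "1 :: 'a" 1] by simp
  moreover have "absval (1 :: 'a) \<noteq> 0" by (simp add: absval_eq_0_iff)
  ultimately show ?thesis by simp
qed

lemma absval_minus [simp]: "absval (- x :: 'a :: nonarchimedean_field) = absval x"
proof -
  have "absval (- 1 :: 'a) * absval (- 1 :: 'a) = 1"
    using absval_mult[of "- 1 :: 'a" "- 1"] by simp
  hence "(absval (- 1 :: 'a))\<^sup>2 = 1" by (simp add: power2_eq_square)
  hence "absval (- 1 :: 'a) = 1"
    using absval_nonneg[of "- 1 :: 'a"] by (auto simp: power2_eq_1_iff)
  thus ?thesis using absval_mult[of "- 1" x] by simp
qed

lemma absval_diff: "absval (x - y :: 'a :: nonarchimedean_field) \<le> max (absval x) (absval y)"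
  using absval_ultrametric[of x "- y"] by simp

typedef (overloaded) 'k valring = "{x :: 'k :: nonarchimedean_field. absval x \<le> 1}"
  morphisms of_valring Abs_valring
  by (rule exI[of _ 0]) simp

setup_lifting type_definition_valring

instantiation valring :: (nonarchimedean_field) idom
begin

lift_definition zero_valring :: "'a valring" is 0 by simp
lift_definition one_valring :: "'a valring" is 1 by simp
lift_definition plus_valring :: "'a valring \<Rightarrow> 'a valring \<Rightarrow> 'a valring" is "(+)"
  by (rule order_trans[OF absval_ultrametric]) simp
lift_definition minus_valring :: "'a valring \<Rightarrow> 'a valring \<Rightarrow> 'a valring" is "(-)"
  by (rule order_trans[OF absval_diff]) simp
lift_definition uminus_valring :: "'a valring \<Rightarrow> 'a valring" is uminus by simp
lift_definition times_valring :: "'a valring \<Rightarrow> 'a valring \<Rightarrow> 'a valring" is "(*)"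
  by (simp add: absval_mult absval_nonneg mult_le_one)

instance
  by standard (transfer; simp add: algebra_simps)+

end

lift_definition residue_eq :: "'k :: nonarchimedean_field valring \<Rightarrow> 'k valring \<Rightarrow> bool"
  is "\<lambda>x y. absval (x - y) < 1" .

lemma equivp_residue_eq: "equivp (residue_eq :: 'k :: nonarchimedean_field valring \<Rightarrow> _)"
proof (rule equivpI)
  show "reflp (residue_eq :: 'k valring \<Rightarrow> _)"
    by (rule reflpI, transfer) simp
  show "symp (residue_eq :: 'k valring \<Rightarrow> _)"
    by (rule sympI, transfer) (metis absval_minus minus_diff_eq)
  show "transp (residue_eq :: 'k valring \<Rightarrow> _)"
  proof (rule transpI, transfer)
    fix x y z :: 'k
    assume "absval (x - y) < 1" "absval (y - z) < 1"
    thus "absval (x - z) < 1"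
      using absval_ultrametric[of "x - y" "y - z"] by simp
  qed
qed

quotient_type (overloaded) 'k residue_field = "'k :: nonarchimedean_field valring" / residue_eq
  morphisms rep_residue_field residue
  by (rule equivp_residue_eq)

lemma residue_eq_mult:
  assumes "residue_eq a b" "residue_eq c d"
  shows "residue_eq (a * c) (b * d)"
  using assms
proof (transfer)
  fix a b c d :: 'a
  assume *: "absval a \<le> 1" "absval b \<le> 1" "absval c \<le> 1" "absval d \<le> 1"
    "absval (a - b) < 1" "absval (c - d) < 1"
  have "a * c - b * d = a * (c - d) + (a - b) * d" by (simp add: algebra_simps)
  moreover have "absval (a * (c - d)) < 1" "absval ((a - b) * d) < 1"
    using * absval_nonneg[of a] absval_nonneg[of d] absval_nonneg[of "a - b"] absval_nonneg[of "c - d"]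
    using mult_left_le_one_le[of "absval (c - d)" "absval a"]
      mult_right_le_one_le[of "absval (a - b)" "absval d"]
    by (simp_all add: absval_mult)
  ultimately show "absval (a * c - b * d) < 1"
    using absval_ultrametric[of "a * (c - d)" "(a - b) * d"] by simp
qed

lemma residue_eq_add:
  assumes "residue_eq a b" "residue_eq c d"
  shows "residue_eq (a + c) (b + d)"
  using assms
proof (transfer)
  fix a b c d :: 'a
  assume "absval (a - b) < 1" "absval (c - d) < 1"
  hence "absval ((a - b) + (c - d)) < 1"
    using absval_ultrametric[of "a - b" "c - d"] by simp
  thus "absval (a + c - (b + d)) < 1" by (simp add: algebra_simps)
qed

lemma residue_eq_uminus: "residue_eq a b \<Longrightarrow> residue_eq (- a) (- b)"
proof transfer
  fix a b :: 'a
  assume "absval (a - b) < 1"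
  moreover have "- a - - b = - (a - b)" by simp
  ultimately show "absval (- a - - b) < 1" by (simp only: absval_minus)
qed

lift_definition valring_inverse :: "'k :: nonarchimedean_field valring \<Rightarrow> 'k valring"
  is "\<lambda>x. if absval x = 1 then inverse x else 0"
proof -
  fix x :: 'k
  show "absval (if absval x = 1 then inverse x else 0) \<le> 1"
    using absval_mult[of x "inverse x"] by (cases "x = 0") auto
qed

lemma residue_eq_inverse:
  assumes "residue_eq a b"
  shows "residue_eq (valring_inverse a) (valring_inverse b)"
  using assms
proof (transfer)
  fix a b :: 'a
  assume *: "absval a \<le> 1" "absval b \<le> 1" "absval (a - b) < 1"
  have "absval b \<le> max (absval a) (absval (a - b))" "absval a \<le> max (absval b) (absval (a - b))"
    using absval_diff[of a "a - b"] absval_ultrametric[of b "a - b"] by simp_all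
  hence iff: "absval a = 1 \<longleftrightarrow> absval b = 1" using * by auto
  show "absval ((if absval a = 1 then inverse a else 0) - (if absval b = 1 then inverse b else 0)) < 1"
  proof (cases "absval a = 1")
    case True
    hence nz: "a \<noteq> 0" "b \<noteq> 0" using iff by auto
    have "a * b * (inverse a - inverse b) = b - a" using nz by (simp add: field_simps)
    hence "absval a * absval b * absval (inverse a - inverse b) = absval (a - b)"
      by (metis absval_mult absval_minus minus_diff_eq)
    thus ?thesis using * True iff by simp
  qed (use iff in auto)
qed

instantiation residue_field :: (nonarchimedean_field) field
begin

lift_definition zero_residue_field :: "'a residue_field" is 0 .
lift_definition one_residue_field :: "'a residue_field" is 1 .
lift_definition plus_residue_field :: "'a residue_field \<Rightarrow> 'a residue_field \<Rightarrow> 'a residue_field"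
  is "(+)" by (rule residue_eq_add)
lift_definition uminus_residue_field :: "'a residue_field \<Rightarrow> 'a residue_field"
  is uminus by (rule residue_eq_uminus)
lift_definition minus_residue_field :: "'a residue_field \<Rightarrow> 'a residue_field \<Rightarrow> 'a residue_field"
  is "(-)" unfolding diff_conv_add_uminus by (intro residue_eq_add residue_eq_uminus)
lift_definition times_residue_field :: "'a residue_field \<Rightarrow> 'a residue_field \<Rightarrow> 'a residue_field"
  is "(*)" by (rule residue_eq_mult)
lift_definition inverse_residue_field :: "'a residue_field \<Rightarrow> 'a residue_field"
  is valring_inverse by (rule residue_eq_inverse)
definition divide_residue_field :: "'a residue_field \<Rightarrow> 'a residue_field \<Rightarrow> 'a residue_field"
  where "divide_residue_field x y = x * inverse y"

instance
proof
  have refl: "residue_eq x x" for x :: "'a valring" by transfer simp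
  fix a b c :: "'a residue_field"
  show "a * b * c = a * (b * c)" by transfer (simp add: refl mult.assoc)
  show "a * b = b * a" by transfer (simp add: refl mult.commute)
  show "1 * a = a" by transfer (simp add: refl)
  show "a + b + c = a + (b + c)" by transfer (simp add: refl add.assoc)
  show "a + b = b + a" by transfer (simp add: refl add.commute)
  show "0 + a = a" by transfer (simp add: refl)
  show "- a + a = 0" by transfer (simp add: refl)
  show "a - b = a + - b" by transfer (simp add: refl)
  show "(a + b) * c = a * c + b * c" by transfer (simp add: refl distrib_right)
  have rel: "\<not> residue_eq (0 :: 'a valring) 1" "valring_inverse (0 :: 'a valring) = 0"
    by (transfer; simp)+
  show "(0 :: 'a residue_field) \<noteq> 1"
    by (simp add: zero_residue_field.abs_eq one_residue_field.abs_eq residue_field.abs_eq_iff rel)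
  show "a div b = a * inverse b" by (simp add: divide_residue_field_def)
  show "inverse (0 :: 'a residue_field) = 0"
    by (simp add: zero_residue_field.abs_eq inverse_residue_field.abs_eq rel)
  have inv: "residue_eq (valring_inverse x * x) 1" if "\<not> residue_eq x 0" for x :: "'a valring"
    using that
  proof transfer
    fix x :: 'a
    assume "absval x \<le> 1" "\<not> absval (x - 0) < 1"
    hence "absval x = 1" "x \<noteq> 0" by auto
    thus "absval ((if absval x = 1 then inverse x else 0) * x - 1) < 1" by simp
  qed
  show "inverse a * a = 1" if "a \<noteq> 0"
    using that
  proof (induction a rule: residue_field.abs_induct)
    case (1 x)
    thus ?case
      using inv[of x]
      by (simp add: zero_residue_field.abs_eq one_residue_field.abs_eq inverse_residue_field.abs_eq
          times_residue_field.abs_eq residue_field.abs_eq_iff)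
  qed
qed

end

lemma of_valring_hom [simp]:
  "of_valring 0 = 0" "of_valring 1 = 1"
  "of_valring (x + y) = of_valring x + of_valring y"
  "of_valring (x * y) = of_valring x * of_valring y"
  by (fact zero_valring.rep_eq one_valring.rep_eq plus_valring.rep_eq times_valring.rep_eq)+

lemma residue_hom [simp]:
  "residue 0 = 0" "residue 1 = 1"
  "residue (x + y) = residue x + residue y"
  "residue (x * y) = residue x * residue y"
  by (fact zero_residue_field.abs_eq[symmetric] one_residue_field.abs_eq[symmetric]
      plus_residue_field.abs_eq[symmetric] times_residue_field.abs_eq[symmetric])+

lemma residue_eq_0_iff: "residue x = 0 \<longleftrightarrow> absval (of_valring x) < 1"
  unfolding zero_residue_field.abs_eq residue_field.abs_eq_iff by (simp add: residue_eq.rep_eq)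

definition rat_degree :: "'a :: field poly fract \<Rightarrow> nat" where
  "rat_degree \<phi> = (THE d. \<exists>f g. g \<noteq> 0 \<and> coprime f g \<and> \<phi> = Fract f g \<and> d = max (degree f) (degree g))"

definition poly_at_fract :: "'a :: field poly \<Rightarrow> 'a poly fract \<Rightarrow> 'a poly fract" where
  "poly_at_fract p \<psi> = poly (map_poly (\<lambda>c. Fract [:c:] 1) p) \<psi>"

text \<open>
  The composition of endomorphisms of the projective line; it is used for non-constant \<open>\<psi>\<close>
  only, where the denominator \<open>g(\<psi>)\<close> does not vanish.
\<close>

definition rat_comp :: "'a :: field poly fract \<Rightarrow> 'a poly fract \<Rightarrow> 'a poly fract" where
  "rat_comp \<phi> \<psi> = (THE \<chi>. \<exists>f g. g \<noteq> 0 \<and> coprime f g \<and> \<phi> = Fract f g \<and>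
                            \<chi> = poly_at_fract f \<psi> / poly_at_fract g \<psi>)"

text \<open>\<open>PGL\<^sub>2(k)\<close> acting on the projective line: the transformations \<open>(az + b)/(cz + d)\<close>.\<close>

definition PGL2 :: "'a :: field poly fract set" where
  "PGL2 = {Fract [:b, a:] [:d, c:] | a b c d. a * d - b * c \<noteq> 0}"

definition PGL2_inv :: "'a :: field poly fract \<Rightarrow> 'a poly fract" where
  "PGL2_inv f = (THE g. g \<in> PGL2 \<and> rat_comp f g = Fract [:0, 1:] 1 \<and> rat_comp g f = Fract [:0, 1:] 1)"

definition Conj_set :: "'a :: field poly fract \<Rightarrow> 'a poly fract \<Rightarrow> 'a poly fract set" where
  "Conj_set \<phi> \<psi> = {f \<in> PGL2. rat_comp (rat_comp f \<phi>) (PGL2_inv f) = \<psi>}"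

definition Aut_set :: "'a :: field poly fract \<Rightarrow> 'a poly fract set" where
  "Aut_set \<phi> = Conj_set \<phi> \<phi>"

text \<open>
  A binary form \<open>\<Sum>i\<le>d. c\<^sub>i X\<^sup>i Y\<^bsup>d-i\<^esup>\<close> of degree \<open>d\<close> is represented by its restriction
  \<open>\<Sum>i\<le>d. c\<^sub>i z\<^sup>i\<close> to the chart \<open>Y \<noteq> 0\<close>, a polynomial of degree at most \<open>d\<close>; the following
  is its restriction to the chart \<open>X \<noteq> 0\<close>.
\<close>

definition at_infinity_chart :: "nat \<Rightarrow> 'r :: comm_ring_1 poly \<Rightarrow> 'r poly" where
  "at_infinity_chart d p = (\<Sum>i\<le>d. monom (coeff p (d - i)) i)"

text \<open>
  Let \<open>R\<close> be a local ring. Every line bundle on the projective line over \<open>R\<close> is some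
  \<open>\<O>(d)\<close>, so a morphism from it to itself over \<open>R\<close> is a pair of
  sections of \<open>\<O>(d)\<close>, i.e. of binary forms of degree \<open>d\<close> over \<open>R\<close>, that generate
  \<open>\<O>(d)\<close> (that is, the unit ideal on each of the two standard charts); the pair is unique up
  to a common unit factor.
\<close>

definition P1_endomorphism :: "nat \<Rightarrow> 'r :: comm_ring_1 poly \<Rightarrow> 'r poly \<Rightarrow> bool" where
  "P1_endomorphism d F G \<longleftrightarrow> degree F \<le> d \<and> degree G \<le> d \<and>
     (\<exists>a b. a * F + b * G = 1) \<and>
     (\<exists>a b. a * at_infinity_chart d F + b * at_infinity_chart d G = 1)"

text \<open>
  \<open>(d, F, G)\<close> is a morphism over the valuation ring whose generic fibre is \<open>\<phi>\<close>.
\<close>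

definition is_model ::
  "nat \<Rightarrow> 'k :: nonarchimedean_field valring poly \<Rightarrow> 'k valring poly \<Rightarrow> 'k poly fract \<Rightarrow> bool" where
  "is_model d F G \<phi> \<longleftrightarrow> P1_endomorphism d F G \<and> map_poly of_valring G \<noteq> 0 \<and>
     \<phi> = Fract (map_poly of_valring F) (map_poly of_valring G)"

definition good_reduction :: "'k :: nonarchimedean_field poly fract \<Rightarrow> bool" where
  "good_reduction \<phi> \<longleftrightarrow> (\<exists>d F G. is_model d F G \<phi>)"

text \<open>
  The special fibre of a model, as a rational function. The only endomorphism of the projective
  line that is not a rational function, the constant \<open>\<infinity>\<close>, is a special fibre of models with
  \<open>d = 0\<close> only, i.e. of constant \<open>\<phi>\<close>.
\<close>

definition reduction ::
  "'k :: nonarchimedean_field poly fract \<Rightarrow> 'k residue_field poly fract" where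
  "reduction \<phi> = (THE \<rho>. \<exists>d F G. is_model d F G \<phi> \<and> map_poly residue G \<noteq> 0 \<and>
                     \<rho> = Fract (map_poly residue F) (map_poly residue G))"

lemma map_poly_mult_hom:
  fixes h :: "'a :: comm_ring_1 \<Rightarrow> 'b :: comm_ring_1"
  assumes "h 0 = 0" "\<And>x y. h (x + y) = h x + h y" "\<And>x y. h (x * y) = h x * h y"
  shows "map_poly h (p * q) = map_poly h p * map_poly h q"
proof (rule poly_eqI)
  have sum: "h (sum f A) = (\<Sum>i\<in>A. h (f i))" if "finite A" for f :: "nat \<Rightarrow> 'a" and A
    using that by (induction A rule: finite_induct) (auto simp: assms)
  fix n show "coeff (map_poly h (p * q)) n = coeff (map_poly h p * map_poly h q) n"
    by (simp add: coeff_map_poly coeff_mult assms sum)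
qed

lemma reduction_eq:
  assumes "is_model d F G \<phi>" "map_poly residue G \<noteq> 0"
  shows "reduction \<phi> = Fract (map_poly residue F) (map_poly residue G)"
  unfolding reduction_def
proof (rule the_equality)
  show "\<exists>d' F' G'. is_model d' F' G' \<phi> \<and> map_poly residue G' \<noteq> 0 \<and>
      Fract (map_poly residue F) (map_poly residue G) = Fract (map_poly residue F') (map_poly residue G')"
    using assms by blast
next
  fix \<rho> assume "\<exists>d' F' G'. is_model d' F' G' \<phi> \<and> map_poly residue G' \<noteq> 0 \<and>
      \<rho> = Fract (map_poly residue F') (map_poly residue G')"
  then obtain d' F' G' where *: "is_model d' F' G' \<phi>" "map_poly residue G' \<noteq> 0"
      "\<rho> = Fract (map_poly residue F') (map_poly residue G')" by blast
  have "map_poly of_valring F * map_poly of_valring G' =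
        map_poly of_valring F' * map_poly of_valring G"
    using assms(1) *(1) by (auto simp: is_model_def eq_fract)
  hence "map_poly of_valring (F * G') = map_poly of_valring (F' * G)"
    by (simp add: map_poly_mult_hom)
  hence "F * G' = F' * G"
    by (intro poly_eqI) (simp add: poly_eq_iff coeff_map_poly of_valring_inject)
  hence "map_poly residue (F * G') = map_poly residue (F' * G)" by simp
  hence "map_poly residue F * map_poly residue G' = map_poly residue F' * map_poly residue G"
    by (simp add: map_poly_mult_hom)
  thus "\<rho> = Fract (map_poly residue F) (map_poly residue G)"
    using *(2,3) assms(2) by (simp add: eq_fract)
qed

end

theory Submission
  imports "HOL-Algebra.Multiplicative_Group" "HOL-Algebra.Algebraic_Closure_Type" Defs
begin

text \<open>
  Write \<open>\<phi>\<close> and \<open>\<psi>\<close> in homogeneous coordinates as pairs \<open>\<Phi>\<close> and \<open>\<Psi>\<close> of binary forms over the valuation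
  ring, and \<open>f\<close> as a matrix \<open>A\<close> with entries in the valuation ring, not all in the maximal ideal. If
  \<open>f\<close> conjugates \<open>\<phi>\<close> to \<open>\<psi>\<close>, then both forms have the same degree \<open>d\<close> and \<open>\<Psi>(Av) = u A\<Phi>(v)\<close> for a
  constant \<open>u\<close> (\<open>Conj_set_forms\<close>).

  Good reduction means that \<open>|\<Phi>(v)| = |v|\<^sup>d\<close> for the maximum norm (\<open>max_norm_P1_endomorphism\<close>). Compare
  the norms of the two sides of the equation at a unit vector that \<open>A\<close> does not shrink and at one that \<open>A\<close>
  shrinks by the factor \<open>|det A|\<close>. This gives \<open>1 \<le> |u| \<le> |det A|\<^sup>d\<^sup>-\<^sup>1\<close>, so \<open>|det A| = 1\<close> as \<open>d \<ge> 2\<close>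
  (\<open>absval_det_conjugating_matrix\<close>). Thus \<open>f\<close> has good reduction, and the conjugation equation, now an
  equation over the valuation ring, reduces to the residue field (\<open>reduction_in_Conj_set\<close>).

  Two conjugating maps with the same reduction differ by an automorphism \<open>h\<close> of \<open>\<phi>\<close> whose matrix \<open>A\<close>
  is congruent to a scalar \<open>r \<noteq> 0\<close> modulo the maximal ideal. By the Cayley-Hamilton theorem the powers
  of \<open>A\<close> are \<open>s\<^sub>n A\<close> plus scalars, with \<open>s\<^sub>n\<close> congruent to \<open>n r\<^sup>n\<^sup>-\<^sup>1\<close>. So if \<open>h\<close> has finite order and
  is killed by some \<open>n\<close> that is invertible in the residue field, then \<open>A\<close> itself is scalar
  (\<open>trivial_reduction_imp_trivial\<close>). If the residue characteristic is positive and prime to the order of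
  the automorphism group, that group is finite and \<open>n\<close> can be its order. If the residue characteristic is
  zero, any \<open>n \<ge> 1\<close> will do, and the finiteness of the order is shown directly: \<open>\<Phi>\<close> maps eigenvectors of
  \<open>A\<close> to eigenvectors, which bounds the order when the eigenvalues differ
  (\<open>eigenvalue_quotient_root_of_unity\<close>), while a non-scalar \<open>A\<close> with a double eigenvalue is a translation
  and would force \<open>\<Phi>\<close> to be linear along a line (\<open>double_eigenvalue_imp_scalar\<close>).
\<close>

section \<open>Binary forms\<close>

definition form_eval :: "nat \<Rightarrow> 'a :: comm_ring_1 poly \<Rightarrow> 'a \<Rightarrow> 'a \<Rightarrow> 'a" where
  "form_eval d F x y = (\<Sum>i\<le>d. coeff F i * x ^ i * y ^ (d - i))"

definition form_subst :: "nat \<Rightarrow> 'a :: comm_ring_1 poly \<Rightarrow> 'a poly \<Rightarrow> 'a poly \<Rightarrow> 'a poly" where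
  "form_subst d F P Q = (\<Sum>i\<le>d. smult (coeff F i) (P ^ i * Q ^ (d - i)))"

locale coeff_hom =
  fixes h :: "'a :: comm_ring_1 \<Rightarrow> 'b :: comm_ring_1"
  assumes hom_0: "h 0 = 0" and hom_1: "h 1 = 1"
    and hom_add: "h (x + y) = h x + h y" and hom_mult: "h (x * y) = h x * h y"
begin

lemma hom_uminus: "h (- x) = - h x"
  using hom_add[of x "- x"] hom_0 by (simp add: eq_neg_iff_add_eq_0 add.commute)

lemma hom_diff: "h (x - y) = h x - h y"
  using hom_add[of x "- y"] by (simp add: hom_uminus)

lemma hom_power: "h (x ^ n) = h x ^ n"
  by (induction n) (simp_all add: hom_1 hom_mult)

lemma hom_sum: "h (sum f S) = (\<Sum>i\<in>S. h (f i))"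
  by (induction S rule: infinite_finite_induct) (simp_all add: hom_0 hom_add)

lemma hom_of_nat: "h (of_nat n) = of_nat n"
  by (induction n) (simp_all add: hom_0 hom_1 hom_add)

lemma map_poly_add: "map_poly h (p + q) = map_poly h p + map_poly h q"
  by (rule poly_eqI) (simp add: coeff_map_poly hom_0 hom_add)

lemma map_poly_mult: "map_poly h (p * q) = map_poly h p * map_poly h q"
  by (rule map_poly_mult_hom) (rule hom_0 hom_add hom_mult)+

lemma map_poly_smult: "map_poly h (smult c p) = smult (h c) (map_poly h p)"
  by (rule poly_eqI) (simp add: coeff_map_poly hom_0 hom_mult)

lemma map_poly_pCons: "map_poly h (pCons c p) = pCons (h c) (map_poly h p)"
  by (rule poly_eqI) (simp add: coeff_map_poly hom_0 coeff_pCons split: nat.split)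

lemma coeff_hom_map_poly: "coeff_hom (map_poly h)"
  by unfold_locales (simp_all add: map_poly_add map_poly_mult hom_1)

lemma degree_map_poly_le: "degree (map_poly h p) \<le> degree p"
  by (rule degree_le) (simp add: coeff_map_poly hom_0 coeff_eq_0)

lemma form_eval_hom: "h (form_eval d F x y) = form_eval d (map_poly h F) (h x) (h y)"
  by (simp add: form_eval_def hom_sum hom_mult hom_power coeff_map_poly hom_0)

lemma form_subst_hom:
  "map_poly h (form_subst d F P Q) =
     form_subst d (map_poly h F) (map_poly h P) (map_poly h Q)"
proof -
  interpret M: coeff_hom "map_poly h" by (rule coeff_hom_map_poly)
  show ?thesis
    by (simp add: form_subst_def M.hom_sum M.hom_mult M.hom_power map_poly_smult coeff_map_poly hom_0)
qed

lemma poly_hom: "h (poly p x) = poly (map_poly h p) (h x)"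
  by (induction p) (simp_all add: map_poly_pCons hom_0 hom_add hom_mult)

lemma at_infinity_chart_hom:
  "map_poly h (at_infinity_chart d F) = at_infinity_chart d (map_poly h F)"
proof -
  interpret M: coeff_hom "map_poly h" by (rule coeff_hom_map_poly)
  show ?thesis
    by (simp add: at_infinity_chart_def M.hom_sum map_poly_monom hom_0 coeff_map_poly)
qed

text \<open>Both Bezout identities persist under base change.\<close>

lemma P1_endomorphism_hom:
  assumes "P1_endomorphism d F G"
  shows "P1_endomorphism d (map_poly h F) (map_poly h G)"
proof -
  interpret M: coeff_hom "map_poly h" by (rule coeff_hom_map_poly)
  have "map_poly h a * map_poly h F + map_poly h b * map_poly h G = 1"
    if "a * F + b * G = 1" for a b F G
    using that by (metis M.hom_1 M.hom_add M.hom_mult)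
  thus ?thesis
    using assms degree_map_poly_le[of F] degree_map_poly_le[of G]
    unfolding P1_endomorphism_def at_infinity_chart_hom[symmetric]
    by (meson le_trans)
qed

end

interpretation of_valring: coeff_hom "of_valring :: 'k :: nonarchimedean_field valring \<Rightarrow> 'k"
  by unfold_locales simp_all

interpretation residue: coeff_hom "residue :: 'k :: nonarchimedean_field valring \<Rightarrow> 'k residue_field"
  by unfold_locales simp_all

interpretation to_ac: coeff_hom "to_ac :: 'k :: field \<Rightarrow> 'k alg_closure"
  by unfold_locales simp_all

lemma inj_map_poly:
  assumes "inj h" "h 0 = 0"
  shows "inj (map_poly h)"
  by (rule injI, rule poly_eqI) (metis assms coeff_map_poly injD)

lemma inj_of_valring: "inj of_valring"
  by (rule injI) (simp add: of_valring_inject)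

lemma poly_form_subst: "poly (form_subst d F P Q) t = form_eval d F (poly P t) (poly Q t)"
  by (simp add: form_subst_def form_eval_def poly_sum mult.assoc)

lemma form_eval_1:
  assumes "degree F \<le> d"
  shows "form_eval d F x 1 = poly F x"
  by (subst poly_as_sum_of_monoms'[OF assms, symmetric])
    (simp add: form_eval_def poly_sum poly_monom)

lemma form_eval_chart: "form_eval d F 1 y = poly (at_infinity_chart d F) y"
proof -
  have "form_eval d F 1 y = (\<Sum>i\<le>d. coeff F i * y ^ (d - i))"
    by (simp add: form_eval_def)
  also have "\<dots> = (\<Sum>i\<le>d. coeff F (d - i) * y ^ i)"
    by (rule sum.reindex_bij_witness[of _ "\<lambda>i. d - i" "\<lambda>i. d - i"]) auto
  finally show ?thesis
    by (simp add: at_infinity_chart_def poly_sum poly_monom)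
qed

lemma form_eval_scale: "form_eval d F (t * x) (t * y) = t ^ d * form_eval d F x y"
  unfolding form_eval_def sum_distrib_left
proof (rule sum.cong)
  fix i assume "i \<in> {..d}"
  hence "t ^ d = t ^ i * t ^ (d - i)" by (simp flip: power_add)
  thus "coeff F i * (t * x) ^ i * (t * y) ^ (d - i) = t ^ d * (coeff F i * x ^ i * y ^ (d - i))"
    by (simp add: power_mult_distrib)
qed simp

lemma form_eval_add: "form_eval d (F + G) x y = form_eval d F x y + form_eval d G x y"
  by (simp add: form_eval_def sum.distrib algebra_simps)

lemma form_eval_smult: "form_eval d (smult c F) x y = c * form_eval d F x y"
  by (simp add: form_eval_def sum_distrib_left mult.assoc)

lemma form_eval_y_0: "form_eval d F x 0 = coeff F d * x ^ d"
proof -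
  have "form_eval d F x 0 = (\<Sum>i\<le>d. if i = d then coeff F d * x ^ d else 0)"
    unfolding form_eval_def by (rule sum.cong) (auto simp: power_0_left)
  thus ?thesis by simp
qed

lemma form_eval_field:
  fixes y :: "'a :: field"
  assumes "degree F \<le> d" "y \<noteq> 0"
  shows "form_eval d F x y = y ^ d * poly F (x / y)"
  using form_eval_scale[of d F y "x / y" 1] assms by (simp add: form_eval_1)

lemma degree_form_subst_linear: "degree (form_subst d F [:b, a:] [:e, c:]) \<le> d"
  unfolding form_subst_def
proof (rule degree_sum_le)
  fix i assume "i \<in> {..d}"
  have l: "degree ([:u, v:] ^ n) \<le> n" for u v :: 'a and n
    using degree_power_le[of "[:u, v:]" n] degree_pCons_le[of u "[:v:]"]
    by (simp add: le_trans[OF degree_power_le])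
  have "degree ([:b, a:] ^ i * [:e, c:] ^ (d - i)) \<le> i + (d - i)"
    by (rule order_trans[OF degree_mult_le]) (intro add_mono l)
  thus "degree (smult (coeff F i) ([:b, a:] ^ i * [:e, c:] ^ (d - i))) \<le> d"
    using degree_smult_le[of "coeff F i" "[:b, a:] ^ i * [:e, c:] ^ (d - i)"] \<open>i \<in> {..d}\<close> by simp
qed simp

lemma coeff_mult_top:
  assumes "degree p \<le> m" "degree q \<le> n"
  shows "coeff (p * q) (m + n) = coeff p m * coeff q n"
proof (cases "degree p = m \<and> degree q = n")
  case True
  thus ?thesis using coeff_mult_degree_sum[of p q] by simp
next
  case False
  hence "degree (p * q) < m + n" "coeff p m * coeff q n = 0"
    using assms degree_mult_le[of p q] by (auto simp: coeff_eq_0 le_less)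
  thus ?thesis by (simp add: coeff_eq_0)
qed

lemma coeff_linear_power: "coeff ([:u, v:] ^ n) n = v ^ n"
proof (induction n)
  case (Suc n)
  have "degree ([:u, v:] ^ n) \<le> n"
    by (rule order_trans[OF degree_power_le]) simp
  with Suc show ?case
    using coeff_mult_top[of "[:u, v:]" 1 "[:u, v:] ^ n" n] by simp
qed simp

text \<open>
  Off the point at infinity both sides are values of polynomials, up to the homogeneity factor; at
  infinity the left-hand side is the top coefficient, to which every summand contributes the product
  of the leading coefficients of its factors.
\<close>

lemma form_eval_linear_subst:
  fixes a b c e x y :: "'a :: field"
  assumes "degree F \<le> d"
  shows "form_eval d (form_subst d F [:b, a:] [:e, c:]) x y =
         form_eval d F (a * x + b * y) (c * x + e * y)"
proof (cases "y = 0")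
  case False
  have "form_eval d (form_subst d F [:b, a:] [:e, c:]) x y =
        y ^ d * form_eval d F (b + x / y * a) (e + x / y * c)"
    using False by (simp add: form_eval_field degree_form_subst_linear poly_form_subst)
  also have "\<dots> = form_eval d F (y * (b + x / y * a)) (y * (e + x / y * c))"
    by (simp only: form_eval_scale)
  also have "y * (b + x / y * a) = a * x + b * y"
    using False by (simp add: field_simps)
  also have "y * (e + x / y * c) = c * x + e * y"
    using False by (simp add: field_simps)
  finally show ?thesis .
next
  case True
  have l: "degree ([:u, v:] ^ n) \<le> n" for u v :: 'a and n
    by (rule order_trans[OF degree_power_le]) simp
  have "coeff (form_subst d F [:b, a:] [:e, c:]) d =
        (\<Sum>i\<le>d. coeff F i * coeff ([:b, a:] ^ i * [:e, c:] ^ (d - i)) d)"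
    by (simp add: form_subst_def coeff_sum)
  also have "\<dots> = form_eval d F a c"
    unfolding form_eval_def
  proof (rule sum.cong)
    fix i assume "i \<in> {..d}"
    thus "coeff F i * coeff ([:b, a:] ^ i * [:e, c:] ^ (d - i)) d = coeff F i * a ^ i * c ^ (d - i)"
      using coeff_mult_top[OF l[of b a i] l[of e c "d - i"]] by (simp add: coeff_linear_power)
  qed simp
  finally show ?thesis
    using True form_eval_scale[of d F x a c] by (simp add: form_eval_y_0 mult.commute)
qed

section \<open>Composition of rational functions over a field\<close>

abbreviation const_fract :: "'a :: field \<Rightarrow> 'a poly fract" where
  "const_fract c \<equiv> Fract [:c:] 1"

abbreviation fract_z :: "'a :: field poly fract" where
  "fract_z \<equiv> Fract [:0, 1:] 1"

definition nonconstant :: "'a :: field poly fract \<Rightarrow> bool" where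
  "nonconstant \<psi> \<longleftrightarrow> (\<forall>c. \<psi> \<noteq> const_fract c)"

lemma coeff_hom_const_fract: "coeff_hom const_fract"
  by unfold_locales (simp_all add: Zero_fract_def One_fract_def one_pCons mult.commute)

lemma Fract_0_left: "Fract 0 x = 0"
  by (rule fract_collapse)

interpretation const_fract: coeff_hom "const_fract :: 'a :: field \<Rightarrow> _"
  by (rule coeff_hom_const_fract)

text \<open>
  An element of least degree in the ideal generated by numerator and denominator divides both;
  cancel it.
\<close>

lemma fract_bezout_representative:
  fixes \<phi> :: "'a :: field poly fract"
  obtains f g a b where "g \<noteq> 0" "\<phi> = Fract f g" "a * f + b * g = 1"
proof -
  obtain p q where pq: "\<phi> = Fract p q" "q \<noteq> 0" by (cases \<phi>)
  define S where "S = {r. r \<noteq> 0 \<and> (\<exists>a b. r = a * p + b * q)}"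
  have "q = 0 * p + 1 * q" by simp
  hence "q \<in> S" using pq unfolding S_def by blast
  then obtain r where r: "r \<in> S" "\<And>s. s \<in> S \<Longrightarrow> degree r \<le> degree s"
    using ex_has_least_nat[of "\<lambda>s. s \<in> S" q degree] by blast
  then obtain a b where ab: "r = a * p + b * q" and "r \<noteq> 0" unfolding S_def by blast
  have "r dvd x" if x: "x = u * p + v * q" for x u v
  proof -
    have "x mod r = x - x div r * r" by (simp add: minus_div_mult_eq_mod)
    also have "\<dots> = (u - x div r * a) * p + (v - x div r * b) * q"
    proof -
      have "x - y * r = (u - y * a) * p + (v - y * b) * q" for y
        by (simp add: x ab algebra_simps)
      thus ?thesis .
    qed
    finally have *: "x mod r = \<dots>" .
    have "\<not> degree r \<le> degree (x mod r)" if "x mod r \<noteq> 0"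
      using degree_mod_less[OF \<open>r \<noteq> 0\<close>, of x] that by simp
    hence "x mod r = 0" using r(2)[of "x mod r"] * unfolding S_def by blast
    thus ?thesis by (simp add: mod_eq_0_iff_dvd)
  qed
  from this[of p 1 0] this[of q 0 1] obtain f g where fg: "p = r * f" "q = r * g"
    by (auto elim!: dvdE)
  have "r * (a * f + b * g) = r * 1" using ab fg by (simp add: algebra_simps)
  hence "a * f + b * g = 1" using \<open>r \<noteq> 0\<close> by (simp only: mult_cancel_left) simp
  moreover have "\<phi> = Fract f g" "g \<noteq> 0"
    using pq fg \<open>r \<noteq> 0\<close> by (auto simp: mult_fract_cancel)
  ultimately show ?thesis using that by blast
qed

lemma poly_at_fract_simps [simp]:
  "poly_at_fract 0 \<psi> = 0" "poly_at_fract 1 \<psi> = 1"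
  "poly_at_fract (pCons c p) \<psi> = const_fract c + \<psi> * poly_at_fract p \<psi>"
  "poly_at_fract (p + q) \<psi> = poly_at_fract p \<psi> + poly_at_fract q \<psi>"
  "poly_at_fract (p * q) \<psi> = poly_at_fract p \<psi> * poly_at_fract q \<psi>"
  "poly_at_fract (smult c p) \<psi> = const_fract c * poly_at_fract p \<psi>"
  by (simp_all add: poly_at_fract_def const_fract.map_poly_pCons const_fract.map_poly_add
      const_fract.map_poly_mult const_fract.map_poly_smult const_fract.hom_1)

lemma poly_at_fract_minus [simp]:
  "poly_at_fract (p - q) \<psi> = poly_at_fract p \<psi> - poly_at_fract q \<psi>"
  using poly_at_fract_simps(4)[of "p - q" q \<psi>] by (simp add: algebra_simps)

lemma Fract_power: "Fract a b ^ n = Fract (a ^ n) (b ^ n)"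
  by (induction n) (simp_all add: One_fract_def)

lemma poly_at_fract_Fract:
  fixes F :: "'a :: field poly"
  assumes "degree F \<le> d" "q \<noteq> 0"
  shows "poly_at_fract F (Fract p q) = Fract (form_subst d F p q) (q ^ d)"
proof -
  interpret to_fract: coeff_hom "\<lambda>p :: 'a poly. Fract p 1"
    by unfold_locales (simp_all add: fract_collapse flip: One_fract_def)
  have 1: "Fract q 1 ^ d \<noteq> 0" using assms(2) by (simp add: Fract_power Zero_fract_def eq_fract)
  have "Fract (form_subst d F p q) 1 =
          (\<Sum>i\<le>d. const_fract (coeff F i) * (Fract p 1 ^ i * Fract q 1 ^ (d - i)))"
    by (simp add: form_subst_def to_fract.hom_sum Fract_power)
  also have "\<dots> = (\<Sum>i\<le>d. const_fract (coeff F i) * Fract p q ^ i * Fract q 1 ^ d)"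
  proof (rule sum.cong)
    fix i assume "i \<in> {..d}"
    hence "Fract p q ^ i * Fract q 1 ^ d = (Fract p q * Fract q 1) ^ i * Fract q 1 ^ (d - i)"
      by (simp add: power_mult_distrib mult.assoc del: mult_fract flip: power_add)
    moreover have "Fract p q * Fract q 1 = Fract p 1" using assms(2) by (simp add: eq_fract)
    ultimately show "const_fract (coeff F i) * (Fract p 1 ^ i * Fract q 1 ^ (d - i)) =
        const_fract (coeff F i) * Fract p q ^ i * Fract q 1 ^ d"
      by (simp only: mult.assoc)
  qed simp
  also have "\<dots> = poly_at_fract F (Fract p q) * Fract q 1 ^ d"
  proof -
    have "degree (map_poly const_fract F) \<le> d"
      using const_fract.degree_map_poly_le[of F] assms(1) by simp
    from form_eval_1[OF this, of "Fract p q"]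
    have "poly_at_fract F (Fract p q) = (\<Sum>i\<le>d. const_fract (coeff F i) * Fract p q ^ i)"
      by (simp add: poly_at_fract_def form_eval_def coeff_map_poly Fract_0_left)
    thus ?thesis by (simp add: sum_distrib_right)
  qed
  finally have "poly_at_fract F (Fract p q) = Fract (form_subst d F p q) 1 / Fract q 1 ^ d"
    using 1 by (simp add: eq_divide_eq)
  thus ?thesis by (simp add: Fract_power)
qed

lemma bezout_dvd_power_imp_unit:
  fixes p q :: "'a :: comm_ring_1"
  assumes "a * p + b * q = 1" "q dvd p ^ n"
  shows "q dvd 1"
  using assms(2)
proof (induction n)
  case (Suc n)
  have "p ^ n = a * p ^ Suc n + (b * p ^ n) * q"
    using arg_cong[OF assms(1), of "\<lambda>x. p ^ n * x"] by (simp add: algebra_simps)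
  with Suc show ?case by (metis dvd_add dvd_mult dvd_triv_right)
qed simp

lemma const_fract_divide: "e \<noteq> 0 \<Longrightarrow> Fract [:c:] [:e:] = const_fract (c / e)"
  by (simp add: eq_fract)

text \<open>
  The field of constants is algebraically closed in the field of rational functions: for coprime
  \<open>p\<close> and \<open>q\<close>, an algebraic equation for \<open>p/q\<close> with non-zero constant term shows that \<open>q\<close> divides
  a power of \<open>p\<close> and \<open>p\<close> a power of \<open>q\<close>.
\<close>

lemma poly_at_fract_nonzero:
  assumes "nonconstant \<psi>" "g \<noteq> 0"
  shows "poly_at_fract g \<psi> \<noteq> 0"
proof
  assume "poly_at_fract g \<psi> = 0"
  thus False using \<open>g \<noteq> 0\<close>
  proof (induction g)
    case (pCons c h)
    obtain p q a b where \<psi>: "q \<noteq> 0" "\<psi> = Fract p q" "a * p + b * q = 1"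
      by (rule fract_bezout_representative)
    have nz: "\<psi> \<noteq> 0" using assms(1) by (metis nonconstant_def const_fract.hom_0)
    show False
    proof (cases "c = 0")
      case True
      thus False using pCons nz by (cases "h = 0") (auto simp: Fract_0_left)
    next
      case False
      define g where "g = pCons c h"
      define n where "n = degree g"
      have g: "coeff g n \<noteq> 0" "coeff g 0 \<noteq> 0"
        using pCons.hyps False by (auto simp: n_def g_def)
      have "Fract (form_subst n g p q) (q ^ n) = 0"
        using pCons.prems \<psi> by (simp flip: poly_at_fract_Fract add: n_def g_def)
      hence 0: "form_subst n g p q = 0" using \<psi>(1) by (simp add: Zero_fract_def eq_fract)
      have "q dvd p ^ n"
      proof -
        have "q dvd (\<Sum>i<n. smult (coeff g i) (p ^ i * q ^ (n - i)))"
          by (rule dvd_sum) (auto intro!: dvd_smult dvd_mult dvd_power)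
        moreover have "form_subst n g p q =
            smult (coeff g n) (p ^ n) + (\<Sum>i<n. smult (coeff g i) (p ^ i * q ^ (n - i)))"
          by (simp add: form_subst_def lessThan_Suc_atMost[symmetric])
        ultimately have "q dvd smult (coeff g n) (p ^ n)"
          using 0 by (simp add: add_eq_0_iff2)
        thus ?thesis using g by (simp add: dvd_smult_iff)
      qed
      moreover have "p dvd q ^ n"
      proof -
        have "p dvd (\<Sum>i\<in>{1..n}. smult (coeff g i) (p ^ i * q ^ (n - i)))"
          by (rule dvd_sum) (auto intro!: dvd_smult dvd_mult2 dvd_power)
        moreover have "{..n} = insert 0 {1..n}" by auto
        hence "form_subst n g p q =
            smult (coeff g 0) (q ^ n) + (\<Sum>i\<in>{1..n}. smult (coeff g i) (p ^ i * q ^ (n - i)))"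
          by (simp add: form_subst_def)
        ultimately have "p dvd smult (coeff g 0) (q ^ n)"
          using 0 by (simp add: add_eq_0_iff2)
        thus ?thesis using g by (simp add: dvd_smult_iff)
      qed
      ultimately have "q dvd 1" "p dvd 1"
        using bezout_dvd_power_imp_unit[of a p b q n] bezout_dvd_power_imp_unit[of b q a p n] \<psi>(3)
        by (simp_all add: add.commute)
      then obtain u v where "p = [:u:]" "q = [:v:]"
        by (auto simp: is_unit_poly_iff)
      thus False using assms(1) \<psi>(1,2) by (auto simp: nonconstant_def const_fract_divide)
    qed
  qed simp
qed

text \<open>
  The value does not depend on the chosen fraction, and the fraction need not be in lowest terms,
  since no denominator vanishes at a non-constant \<open>\<psi>\<close>.
\<close>

lemma rat_comp_Fract:
  assumes "nonconstant \<psi>" "g \<noteq> 0"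
  shows "rat_comp (Fract f g) \<psi> = poly_at_fract f \<psi> / poly_at_fract g \<psi>"
  unfolding rat_comp_def
proof (rule the_equality)
  have eq: "poly_at_fract f \<psi> / poly_at_fract g \<psi> = poly_at_fract f' \<psi> / poly_at_fract g' \<psi>"
    if "g' \<noteq> 0" "Fract f g = Fract f' g'" for f' g'
  proof -
    have "f * g' = f' * g" using that assms by (simp add: eq_fract)
    hence "poly_at_fract f \<psi> * poly_at_fract g' \<psi> = poly_at_fract f' \<psi> * poly_at_fract g \<psi>"
      by (metis poly_at_fract_simps(5))
    thus ?thesis using poly_at_fract_nonzero[OF assms(1)] that assms(2) by (simp add: frac_eq_eq)
  qed
  obtain f' g' a b where *: "g' \<noteq> 0" "Fract f g = Fract f' g'" "a * f' + b * g' = 1"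
    by (rule fract_bezout_representative)
  have "coprime f' g'"
    by (rule coprimeI) (metis *(3) dvd_add dvd_mult)
  thus "\<exists>f' g'. g' \<noteq> 0 \<and> coprime f' g' \<and> Fract f g = Fract f' g' \<and>
      poly_at_fract f \<psi> / poly_at_fract g \<psi> = poly_at_fract f' \<psi> / poly_at_fract g' \<psi>"
    using * eq by blast
  show "\<chi> = poly_at_fract f \<psi> / poly_at_fract g \<psi>"
    if "\<exists>f' g'. g' \<noteq> 0 \<and> coprime f' g' \<and> Fract f g = Fract f' g' \<and>
          \<chi> = poly_at_fract f' \<psi> / poly_at_fract g' \<psi>" for \<chi>
    using that eq by metis
qed

lemma coeff_hom_rat_comp:
  assumes "nonconstant \<psi>"
  shows "coeff_hom (\<lambda>\<phi>. rat_comp \<phi> \<psi>)"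
proof
  note nz = poly_at_fract_nonzero[OF assms]
  show "rat_comp 0 \<psi> = 0" "rat_comp 1 \<psi> = 1"
    using rat_comp_Fract[OF assms, of 1 0] rat_comp_Fract[OF assms, of 1 1]
    by (simp_all add: fract_collapse)
  fix x y :: "'a poly fract"
  obtain p q u v where xy: "x = Fract p q" "q \<noteq> 0" "y = Fract u v" "v \<noteq> 0"
    by (metis Fract_cases)
  show "rat_comp (x + y) \<psi> = rat_comp x \<psi> + rat_comp y \<psi>"
    using xy nz by (simp add: rat_comp_Fract[OF assms] add_frac_eq)
  show "rat_comp (x * y) \<psi> = rat_comp x \<psi> * rat_comp y \<psi>"
    using xy by (simp add: rat_comp_Fract[OF assms])
qed

lemma rat_comp_const_fract: "nonconstant \<psi> \<Longrightarrow> rat_comp (const_fract c) \<psi> = const_fract c"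
  by (simp add: rat_comp_Fract)

lemma rat_comp_divide:
  assumes "nonconstant \<psi>"
  shows "rat_comp (x / y) \<psi> = rat_comp x \<psi> / rat_comp y \<psi>"
proof -
  interpret coeff_hom "\<lambda>\<phi>. rat_comp \<phi> \<psi>" by (rule coeff_hom_rat_comp[OF assms])
  show ?thesis
  proof (cases "y = 0")
    case False
    have "rat_comp (x / y) \<psi> * rat_comp y \<psi> = rat_comp x \<psi>"
         "rat_comp (1 / y) \<psi> * rat_comp y \<psi> = 1"
      using False by (simp_all flip: hom_mult add: hom_1)
    thus ?thesis by (metis eq_divide_eq mult_zero_right zero_neq_one)
  qed (simp add: hom_0)
qed

lemma rat_comp_poly_at_fract:
  assumes "nonconstant \<psi>"
  shows "rat_comp (poly_at_fract p \<phi>) \<psi> = poly_at_fract p (rat_comp \<phi> \<psi>)"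
proof -
  interpret coeff_hom "\<lambda>\<phi>. rat_comp \<phi> \<psi>" by (rule coeff_hom_rat_comp[OF assms])
  have "map_poly (\<lambda>\<phi>. rat_comp \<phi> \<psi>) (map_poly const_fract p) = map_poly const_fract p"
    by (subst map_poly_map_poly) (simp_all add: hom_0 Fract_0_left o_def rat_comp_const_fract[OF assms])
  thus ?thesis by (simp add: poly_at_fract_def poly_hom)
qed

lemma nonconstant_rat_comp:
  assumes "nonconstant \<phi>" "nonconstant \<psi>"
  shows "nonconstant (rat_comp \<phi> \<psi>)"
  unfolding nonconstant_def
proof (intro allI notI)
  fix c assume c: "rat_comp \<phi> \<psi> = const_fract c"
  obtain f g where \<phi>: "\<phi> = Fract f g" "g \<noteq> 0" by (cases \<phi>)
  have nz: "poly_at_fract g \<psi> \<noteq> 0" by (rule poly_at_fract_nonzero) fact+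
  have "poly_at_fract (f - smult c g) \<psi> = 0"
    using c nz \<phi> assms(2) by (simp add: rat_comp_Fract divide_eq_eq)
  hence "f = smult c g" using poly_at_fract_nonzero[OF assms(2), of "f - smult c g"] by auto
  hence "\<phi> = const_fract c" using \<phi> by (simp add: eq_fract)
  thus False using assms(1) unfolding nonconstant_def by blast
qed

text \<open>
  Substitution of \<open>\<psi>\<close> is a field homomorphism that fixes the constants, so it commutes with
  evaluating the numerator and the denominator of \<open>\<chi>\<close> at \<open>\<phi>\<close>.
\<close>

lemma rat_comp_assoc:
  assumes "nonconstant \<phi>" "nonconstant \<psi>"
  shows "rat_comp (rat_comp \<chi> \<phi>) \<psi> = rat_comp \<chi> (rat_comp \<phi> \<psi>)"
proof -
  obtain f g where "\<chi> = Fract f g" "g \<noteq> 0" by (cases \<chi>)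
  thus ?thesis using assms
    by (simp add: rat_comp_Fract nonconstant_rat_comp rat_comp_divide rat_comp_poly_at_fract)
qed

lemma nonconstant_z: "nonconstant fract_z"
  by (simp add: nonconstant_def eq_fract)

lemma poly_at_fract_z: "poly_at_fract p fract_z = Fract p 1"
proof (induction p)
  case (pCons c p)
  thus ?case by (simp add: pCons.IH)
qed (simp add: Zero_fract_def)

lemma rat_comp_z_right: "rat_comp \<phi> fract_z = \<phi>"
proof -
  obtain f g where "\<phi> = Fract f g" "g \<noteq> 0" by (cases \<phi>)
  thus ?thesis by (simp add: rat_comp_Fract nonconstant_z poly_at_fract_z)
qed

lemma rat_comp_z_left: "nonconstant \<psi> \<Longrightarrow> rat_comp fract_z \<psi> = \<psi>"
  by (simp add: rat_comp_Fract Fract_0_left const_fract.hom_1)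

subsection \<open>Moebius transformations\<close>

abbreviation moebius :: "'a :: field \<Rightarrow> 'a \<Rightarrow> 'a \<Rightarrow> 'a \<Rightarrow> 'a poly fract" where
  "moebius a b c e \<equiv> Fract [:b, a:] [:e, c:]"

lemma moebius_eq_z_iff:
  assumes "[:e, c:] \<noteq> 0"
  shows "moebius a b c e = fract_z \<longleftrightarrow> b = 0 \<and> c = 0 \<and> a = e"
  using assms by (auto simp: eq_fract)

lemma moebius_scale: "t \<noteq> 0 \<Longrightarrow> moebius (t * a) (t * b) (t * c) (t * e) = moebius a b c e"
  using mult_fract_cancel[of "[:t:]" "[:b, a:]" "[:e, c:]"] by (simp add: mult.commute)

lemma moebius_denom_nonzero: "a * e - b * c \<noteq> 0 \<Longrightarrow> [:e, c:] \<noteq> (0 :: 'a :: field poly)"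
  by auto

lemma nonconstant_moebius:
  assumes "a * e - b * c \<noteq> 0"
  shows "nonconstant (moebius a b c e)"
  unfolding nonconstant_def
proof (intro allI notI)
  fix t assume "moebius a b c e = const_fract t"
  hence "b = t * e" "a = t * c"
    using moebius_denom_nonzero[OF assms] by (auto simp: eq_fract)
  thus False using assms by simp
qed

lemma nonconstant_Fract_denom: "nonconstant (Fract F G) \<Longrightarrow> G \<noteq> 0"
  by (metis fract_collapse(3) const_fract.hom_0 nonconstant_def)

lemma rat_comp_moebius_left:
  fixes F G :: "'a :: field poly"
  assumes "nonconstant (Fract F G)" "a * e - b * c \<noteq> 0"
  shows "rat_comp (moebius a b c e) (Fract F G) = Fract (smult a F + smult b G) (smult c F + smult e G)"
    and "smult c F + smult e G \<noteq> 0"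
proof -
  have G: "G \<noteq> 0" using assms(1) by (rule nonconstant_Fract_denom)
  have *: "poly_at_fract [:v, u:] (Fract F G) = Fract (smult u F + smult v G) G" for u v
    using G by (simp add: eq_fract algebra_simps)
  show nz: "smult c F + smult e G \<noteq> 0"
  proof
    assume 0: "smult c F + smult e G = 0"
    have "poly_at_fract [:e, c:] (Fract F G) = 0"
      unfolding * 0 by (simp add: fract_collapse)
    thus False
      using poly_at_fract_nonzero[OF assms(1)] moebius_denom_nonzero[OF assms(2)] by blast
  qed
  show "rat_comp (moebius a b c e) (Fract F G) = Fract (smult a F + smult b G) (smult c F + smult e G)"
    unfolding rat_comp_Fract[OF assms(1) moebius_denom_nonzero[OF assms(2)]] *
    using G nz by (simp add: eq_fract)
qed

lemma rat_comp_moebius_right: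
  fixes F G :: "'a :: field poly"
  assumes "a * e - b * c \<noteq> 0" "degree F \<le> d" "degree G \<le> d" "G \<noteq> 0"
  shows "rat_comp (Fract F G) (moebius a b c e) =
           Fract (form_subst d F [:b, a:] [:e, c:]) (form_subst d G [:b, a:] [:e, c:])"
    and "form_subst d G [:b, a:] [:e, c:] \<noteq> 0"
proof -
  note nc = nonconstant_moebius[OF assms(1)] and nz = moebius_denom_nonzero[OF assms(1)]
  note eq = poly_at_fract_Fract[OF _ nz]
  have nz': "[:e, c:] ^ d \<noteq> 0" using nz by (rule power_not_zero)
  show *: "form_subst d G [:b, a:] [:e, c:] \<noteq> 0"
  proof
    assume "form_subst d G [:b, a:] [:e, c:] = 0"
    hence "poly_at_fract G (moebius a b c e) = 0"
      by (simp add: eq[OF assms(3)] fract_collapse)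
    thus False using poly_at_fract_nonzero[OF nc assms(4)] by simp
  qed
  show "rat_comp (Fract F G) (moebius a b c e) =
           Fract (form_subst d F [:b, a:] [:e, c:]) (form_subst d G [:b, a:] [:e, c:])"
    unfolding rat_comp_Fract[OF nc assms(4)] eq[OF assms(2)] eq[OF assms(3)]
    using nz' * by (simp add: eq_fract mult_ac)
qed

lemma rat_comp_moebius:
  assumes "a * e - b * c \<noteq> 0" "a' * e' - b' * c' \<noteq> 0"
  shows "rat_comp (moebius a b c e) (moebius a' b' c' e') =
         moebius (a * a' + b * c') (a * b' + b * e') (c * a' + e * c') (c * b' + e * e')"
  using rat_comp_moebius_left(1)[OF nonconstant_moebius[OF assms(2)] assms(1)]
  by (simp add: algebra_simps)

lemma det_mult_nonzero:
  fixes a :: "'a :: field"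
  assumes "a * e - b * c \<noteq> 0" "a' * e' - b' * c' \<noteq> 0"
  shows "(a * a' + b * c') * (c * b' + e * e') - (a * b' + b * e') * (c * a' + e * c') \<noteq> 0"
proof -
  have "(a * a' + b * c') * (c * b' + e * e') - (a * b' + b * e') * (c * a' + e * c') =
        (a * e - b * c) * (a' * e' - b' * c')" by (simp add: algebra_simps)
  thus ?thesis using assms by simp
qed

lemma PGL2E:
  assumes "f \<in> PGL2"
  obtains a b c e where "f = moebius a b c e" "a * e - b * c \<noteq> 0"
  using assms by (auto simp: PGL2_def)

lemma moebius_in_PGL2: "a * e - b * c \<noteq> 0 \<Longrightarrow> moebius a b c e \<in> PGL2"
  unfolding PGL2_def by blast

lemma PGL2_nonconstant: "f \<in> PGL2 \<Longrightarrow> nonconstant f"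
  by (auto elim!: PGL2E intro: nonconstant_moebius)

lemma z_in_PGL2: "fract_z \<in> PGL2"
  using moebius_in_PGL2[of 1 1 0 0] by (simp add: one_pCons)

lemma PGL2_rat_comp: "f \<in> PGL2 \<Longrightarrow> g \<in> PGL2 \<Longrightarrow> rat_comp f g \<in> PGL2"
  by (erule PGL2E, erule PGL2E, hypsubst, subst rat_comp_moebius)
    (assumption | intro moebius_in_PGL2 det_mult_nonzero)+

lemma moebius_adjugate:
  assumes "a * e - b * c \<noteq> 0"
  shows "rat_comp (moebius a b c e) (moebius e (- b) (- c) a) = fract_z"
    and "rat_comp (moebius e (- b) (- c) a) (moebius a b c e) = fract_z"
    and "e * a - (- b) * (- c) \<noteq> 0"
proof -
  show d: "e * a - (- b) * (- c) \<noteq> 0" using assms by (simp add: mult.commute)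
  have s: "moebius t 0 0 t = fract_z" if "t \<noteq> 0" for t :: 'a
    using that by (simp add: eq_fract)
  show "rat_comp (moebius a b c e) (moebius e (- b) (- c) a) = fract_z"
    using rat_comp_moebius[OF assms d] s[OF assms] by (simp add: algebra_simps)
  show "rat_comp (moebius e (- b) (- c) a) (moebius a b c e) = fract_z"
    using rat_comp_moebius[OF d assms] s[OF assms] by (simp add: algebra_simps)
qed

lemma PGL2_inv:
  assumes "f \<in> PGL2"
  shows "PGL2_inv f \<in> PGL2" "rat_comp f (PGL2_inv f) = fract_z" "rat_comp (PGL2_inv f) f = fract_z"
proof -
  obtain a b c e where f: "f = moebius a b c e" and det: "a * e - b * c \<noteq> 0"
    using assms by (rule PGL2E)
  let ?P = "\<lambda>g. g \<in> PGL2 \<and> rat_comp f g = fract_z \<and> rat_comp g f = fract_z"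
  define g where "g = moebius e (- b) (- c) a"
  have g: "?P g"
    using moebius_adjugate[OF det] moebius_in_PGL2[OF moebius_adjugate(3)[OF det]]
    by (simp add: f g_def)
  have "h = g" if "?P h" for h
  proof -
    have "h = rat_comp h (rat_comp f g)" using g by (simp add: rat_comp_z_right)
    also have "\<dots> = rat_comp (rat_comp h f) g"
      using g assms by (simp add: rat_comp_assoc PGL2_nonconstant)
    also have "\<dots> = g" using that g by (simp add: rat_comp_z_left PGL2_nonconstant)
    finally show ?thesis .
  qed
  with g have "?P (PGL2_inv f)" unfolding PGL2_inv_def by (rule theI)
  thus "PGL2_inv f \<in> PGL2" "rat_comp f (PGL2_inv f) = fract_z" "rat_comp (PGL2_inv f) f = fract_z"
    by auto
qed

text \<open>
  The form without the inverse can be compared coefficientwise with models over the valuation ring.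
\<close>

lemma Conj_set_iff:
  assumes "nonconstant \<phi>"
  shows "f \<in> Conj_set \<phi> \<psi> \<longleftrightarrow> f \<in> PGL2 \<and> rat_comp f \<phi> = rat_comp \<psi> f"
proof (cases "f \<in> PGL2")
  case True
  note inv = PGL2_inv[OF True] and nc = PGL2_nonconstant[OF True]
  have "rat_comp (rat_comp f \<phi>) (PGL2_inv f) = \<psi>" if "rat_comp f \<phi> = rat_comp \<psi> f"
    unfolding that using inv nc by (simp add: rat_comp_assoc PGL2_nonconstant rat_comp_z_right)
  moreover have "rat_comp f \<phi> = rat_comp \<psi> f" if "rat_comp (rat_comp f \<phi>) (PGL2_inv f) = \<psi>"
    unfolding that[symmetric] using inv nc
    by (simp add: rat_comp_assoc PGL2_nonconstant rat_comp_z_right nonconstant_rat_comp assms)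
  ultimately show ?thesis using True by (auto simp: Conj_set_def)
qed (simp add: Conj_set_def)

lemma Conj_set_inv:
  assumes "f \<in> Conj_set \<phi> \<psi>" "nonconstant \<phi>" "nonconstant \<psi>"
  shows "PGL2_inv f \<in> Conj_set \<psi> \<phi>"
proof -
  have f: "f \<in> PGL2" and eq: "rat_comp f \<phi> = rat_comp \<psi> f"
    using assms by (auto simp: Conj_set_iff)
  let ?g = "PGL2_inv f"
  note g = PGL2_inv[OF f] and nc = PGL2_nonconstant[OF f] PGL2_nonconstant[OF PGL2_inv(1)[OF f]]
  have "rat_comp ?g \<psi> = rat_comp ?g (rat_comp (rat_comp f \<phi>) ?g)"
    using g nc assms by (simp add: eq rat_comp_assoc rat_comp_z_right)
  also have "\<dots> = rat_comp (rat_comp ?g (rat_comp f \<phi>)) ?g"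
    using nc assms by (simp add: rat_comp_assoc nonconstant_rat_comp)
  also have "rat_comp ?g (rat_comp f \<phi>) = \<phi>"
    using g nc assms by (simp add: rat_comp_assoc[symmetric] rat_comp_z_left)
  finally show ?thesis using g assms by (simp add: Conj_set_iff)
qed

lemma Conj_set_comp:
  assumes "f \<in> Conj_set \<phi> \<psi>" "g \<in> Conj_set \<psi> \<chi>" "nonconstant \<phi>" "nonconstant \<psi>"
  shows "rat_comp g f \<in> Conj_set \<phi> \<chi>"
proof -
  have fg: "f \<in> PGL2" "rat_comp f \<phi> = rat_comp \<psi> f" "g \<in> PGL2" "rat_comp g \<psi> = rat_comp \<chi> g"
    using assms by (auto simp: Conj_set_iff)
  note nc = PGL2_nonconstant[OF fg(1)] PGL2_nonconstant[OF fg(3)] assms(3,4)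
  have "rat_comp (rat_comp g f) \<phi> = rat_comp g (rat_comp \<psi> f)"
    using nc fg by (simp add: rat_comp_assoc)
  also have "\<dots> = rat_comp (rat_comp \<chi> g) f"
    using nc fg by (simp add: rat_comp_assoc[symmetric])
  also have "\<dots> = rat_comp \<chi> (rat_comp g f)"
    using nc by (simp add: rat_comp_assoc)
  finally show ?thesis using fg nc by (simp add: Conj_set_iff PGL2_rat_comp)
qed

section \<open>Endomorphisms of the projective line over a field\<close>

lemma P1_endomorphismE:
  assumes "P1_endomorphism d F G"
  obtains "degree F \<le> d" "degree G \<le> d"
    and "\<And>t. \<exists>a b. a * form_eval d F t 1 + b * form_eval d G t 1 = 1"
    and "\<And>t. \<exists>a b. a * form_eval d F 1 t + b * form_eval d G 1 t = 1"
proof -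
  from assms obtain a b a' b' where *: "degree F \<le> d" "degree G \<le> d" "a * F + b * G = 1"
      "a' * at_infinity_chart d F + b' * at_infinity_chart d G = 1"
    unfolding P1_endomorphism_def by blast
  have "poly a t * form_eval d F t 1 + poly b t * form_eval d G t 1 = 1" for t
    using arg_cong[OF *(3), of "\<lambda>p. poly p t"] *(1,2) by (simp add: form_eval_1)
  moreover have "poly a' t * form_eval d F 1 t + poly b' t * form_eval d G 1 t = 1" for t
    using arg_cong[OF *(4), of "\<lambda>p. poly p t"] by (simp add: form_eval_chart)
  ultimately show ?thesis using that * by blast
qed

lemma P1_endomorphism_top_coeff:
  fixes F :: "'a :: comm_ring_1 poly"
  assumes "P1_endomorphism d F G"
  shows "coeff F d \<noteq> 0 \<or> coeff G d \<noteq> 0"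
  using assms by (rule P1_endomorphismE) (metis form_eval_y_0 mult_zero_left mult_zero_right add_0 zero_neq_one)

text \<open>The two charts cover the projective line, so the two forms have no common zero.\<close>

lemma P1_endomorphism_no_common_zero:
  fixes F :: "'a :: field poly"
  assumes "P1_endomorphism d F G" "x \<noteq> 0 \<or> y \<noteq> 0"
  shows "form_eval d F x y \<noteq> 0 \<or> form_eval d G x y \<noteq> 0"
proof (cases "y = 0")
  case True
  thus ?thesis using P1_endomorphism_top_coeff[OF assms(1)] assms(2) by (simp add: form_eval_y_0)
next
  case False
  hence *: "form_eval d H x y = y ^ d * form_eval d H (x / y) 1" for H
    using form_eval_scale[of d H y "x / y" 1] by simp
  from assms(1) obtain a b where "a * form_eval d F (x / y) 1 + b * form_eval d G (x / y) 1 = 1"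
    by (metis P1_endomorphismE)
  thus ?thesis unfolding * using False by auto
qed

lemma P1_endomorphism_nonconstant:
  fixes F :: "'a :: field poly"
  assumes "P1_endomorphism d F G" "d \<ge> 1"
  shows "G \<noteq> 0" "nonconstant (Fract F G)"
proof -
  obtain a b where ab: "a * F + b * G = 1" using assms unfolding P1_endomorphism_def by blast
  note top = P1_endomorphism_top_coeff[OF assms(1)]
  have 0: "coeff p d = 0" if "p dvd 1" for p :: "'a poly"
    using that assms(2) by (auto simp: is_unit_poly_iff coeff_eq_0)
  show G: "G \<noteq> 0"
  proof
    assume "G = 0"
    moreover from this have "F dvd 1" using ab by (metis add.right_neutral dvd_triv_right mult_zero_right)
    ultimately show False using top 0 by simp
  qed
  show "nonconstant (Fract F G)"
    unfolding nonconstant_def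
  proof (intro allI notI)
    fix t assume "Fract F G = const_fract t"
    hence F: "F = smult t G" using G by (simp add: eq_fract)
    hence "(smult t a + b) * G = 1" using ab by (simp add: algebra_simps)
    hence "G dvd 1" by (metis dvd_triv_right)
    thus False using top 0 F by simp
  qed
qed

text \<open>
  This is the uniqueness of a fraction in lowest terms, for any commutative ring: multiply the
  Bezout identity by \<open>f\<close> and by \<open>g\<close>.
\<close>

lemma bezout_proportional:
  fixes F G f g a b :: "'a :: comm_ring_1"
  assumes "a * F + b * G = 1" "F * g = f * G"
  defines "u \<equiv> a * f + b * g"
  shows "f = F * u" "g = G * u"
proof -
  have "F * u = a * F * f + b * (F * g)" by (simp add: u_def algebra_simps)
  also have "\<dots> = (a * F + b * G) * f" by (simp only: assms(2)) (simp add: algebra_simps)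
  finally show "f = F * u" by (simp add: assms(1))
  have "G * u = a * (f * G) + b * G * g" by (simp add: u_def algebra_simps)
  also have "\<dots> = (a * F + b * G) * g" by (simp only: flip: assms(2)) (simp add: algebra_simps)
  finally show "g = G * u" by (simp add: assms(1))
qed

lemma rat_degree_P1_endomorphism:
  fixes F :: "'a :: field poly"
  assumes "P1_endomorphism d F G" "G \<noteq> 0"
  shows "rat_degree (Fract F G) = d"
  unfolding rat_degree_def
proof (rule the_equality)
  obtain a b where ab: "a * F + b * G = 1" using assms unfolding P1_endomorphism_def by blast
  have cop: "coprime F G" by (rule coprimeI) (metis ab dvd_add dvd_mult)
  have deg: "max (degree F) (degree G) = d"
    using assms(1) P1_endomorphism_top_coeff[OF assms(1)] le_degree
    unfolding P1_endomorphism_def max_def by (metis le_antisym)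
  show "\<exists>f g. g \<noteq> 0 \<and> coprime f g \<and> Fract F G = Fract f g \<and> d = max (degree f) (degree g)"
    using cop deg assms(2) by metis
  fix m assume "\<exists>f g. g \<noteq> 0 \<and> coprime f g \<and> Fract F G = Fract f g \<and> m = max (degree f) (degree g)"
  then obtain f g where fg: "g \<noteq> 0" "coprime f g" "F * g = f * G" "m = max (degree f) (degree g)"
    using assms(2) by (auto simp: eq_fract)
  define u where "u = a * f + b * g"
  have u: "f = F * u" "g = G * u"
    using bezout_proportional[OF ab fg(3)] by (simp_all add: u_def)
  hence "u dvd 1" using fg(2) by (metis coprime_common_divisor dvd_triv_right)
  then obtain c where "u = [:c:]" by (auto simp: is_unit_poly_iff)
  moreover from this have "c \<noteq> 0" using fg(1) u by auto
  ultimately show "m = d" using fg(4) deg by (simp add: u)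
qed

text \<open>
  Clearing denominators in \<open>f \<circ> \<phi> = \<psi> \<circ> f\<close>, for \<open>\<phi> = F/G\<close>, \<open>\<psi> = F'/G'\<close> and \<open>f\<close> with matrix
  \<open>(a b; c e)\<close>, gives an equation over every commutative ring, which can therefore be moved between
  the field, its valuation ring and the residue field.
\<close>

definition conj_equation ::
  "nat \<Rightarrow> 'a :: comm_ring_1 poly \<Rightarrow> 'a poly \<Rightarrow> 'a poly \<Rightarrow> 'a poly \<Rightarrow> 'a \<Rightarrow> 'a \<Rightarrow> 'a \<Rightarrow> 'a \<Rightarrow> bool" where
  "conj_equation n F G F' G' a b c e \<longleftrightarrow>
     (smult a F + smult b G) * form_subst n G' [:b, a:] [:e, c:] =
     form_subst n F' [:b, a:] [:e, c:] * (smult c F + smult e G)"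

lemma moebius_in_Conj_set_iff:
  fixes F G F' G' :: "'a :: field poly"
  assumes "a * e - b * c \<noteq> 0" "nonconstant (Fract F G)"
    and "degree F' \<le> n" "degree G' \<le> n" "G' \<noteq> 0"
  shows "moebius a b c e \<in> Conj_set (Fract F G) (Fract F' G') \<longleftrightarrow> conj_equation n F G F' G' a b c e"
  using rat_comp_moebius_left[OF assms(2,1)] rat_comp_moebius_right[OF assms(1,3,4,5)]
    moebius_in_PGL2[OF assms(1)]
  by (simp add: Conj_set_iff[OF assms(2)] conj_equation_def eq_fract)

lemma (in coeff_hom) conj_equation_hom:
  assumes "conj_equation n F G F' G' a b c e"
  shows "conj_equation n (map_poly h F) (map_poly h G) (map_poly h F') (map_poly h G')
           (h a) (h b) (h c) (h e)"
  using arg_cong[OF assms[unfolded conj_equation_def], of "map_poly h"]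
  by (simp add: conj_equation_def map_poly_mult map_poly_add map_poly_smult map_poly_pCons
      form_subst_hom)

lemma (in coeff_hom) conj_equation_hom_iff:
  assumes "inj h"
  shows "conj_equation n (map_poly h F) (map_poly h G) (map_poly h F') (map_poly h G')
           (h a) (h b) (h c) (h e) \<longleftrightarrow> conj_equation n F G F' G' a b c e"
proof -
  have "map_poly h p = map_poly h q \<longleftrightarrow> p = q" for p q
    using inj_map_poly[OF assms hom_0] by (simp add: inj_eq)
  moreover have "map_poly h [:x, y:] = [:h x, h y:]" for x y by (simp add: map_poly_pCons)
  ultimately show ?thesis
    by (simp only: conj_equation_def map_poly_mult[symmetric] map_poly_add[symmetric]
        map_poly_smult[symmetric] form_subst_hom[symmetric] flip: \<open>\<And>x y. map_poly h [:x, y:] = _\<close>)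
qed

text \<open>
  Because \<open>A\<close> is invertible, the two components of \<open>A\<Phi>\<close> generate the unit ideal like those of \<open>\<Phi>\<close>,
  and one of them has degree exactly \<open>d\<close>. Hence the fraction they form is in lowest terms.
\<close>

lemma conj_equation_factor:
  fixes F G F' G' :: "'a :: field poly"
  assumes "conj_equation n F G F' G' a b c e" "a * e - b * c \<noteq> 0"
    and "P1_endomorphism d F G" "P1_endomorphism n F' G'" "n \<ge> 1"
  obtains u where "u \<noteq> 0"
    "form_subst n F' [:b, a:] [:e, c:] = u * (smult a F + smult b G)"
    "form_subst n G' [:b, a:] [:e, c:] = u * (smult c F + smult e G)"
    "degree u + d \<le> n"
proof -
  define D where "D = a * e - b * c"
  have D: "D \<noteq> 0" using assms by (simp add: D_def)
  define F1 where "F1 = smult a F + smult b G"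
  define G1 where "G1 = smult c F + smult e G"
  define F2 where "F2 = form_subst n F' [:b, a:] [:e, c:]"
  define G2 where "G2 = form_subst n G' [:b, a:] [:e, c:]"
  have FG: "smult D F = smult e F1 - smult b G1" "smult D G = smult a G1 - smult c F1"
    by (simp_all add: F1_def G1_def D_def algebra_simps smult_add_left smult_diff_left smult_add_right)
  obtain p q where "p * F + q * G = 1" using assms(3) unfolding P1_endomorphism_def by blast
  hence "smult D (p * F + q * G) = smult D 1" by simp
  hence "p * smult D F + q * smult D G = [:D:]" by (simp add: smult_add_right)
  hence "(smult e p - smult c q) * F1 + (smult a q - smult b p) * G1 = [:D:]"
    unfolding FG by (simp add: algebra_simps)
  hence "smult (inverse D) ((smult e p - smult c q) * F1 + (smult a q - smult b p) * G1) =
          smult (inverse D) [:D:]" by simp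
  then obtain r s where rs: "r * F1 + s * G1 = 1"
    using D by (metis mult_smult_left smult_add_right smult_pCons left_inverse smult_0_right one_pCons)
  have cross: "F1 * G2 = F2 * G1"
    using assms(1) by (simp add: conj_equation_def F1_def F2_def G1_def G2_def)
  define u where "u = r * F2 + s * G2"
  have u: "F2 = u * F1" "G2 = u * G1"
    using bezout_proportional[OF rs cross] by (simp_all add: u_def mult.commute)
  have "G2 \<noteq> 0"
    using rat_comp_moebius_right(2)[of a e b c F' n G'] assms
      P1_endomorphism_nonconstant(1)[OF assms(4,5)]
    by (auto simp: G2_def P1_endomorphism_def)
  hence "u \<noteq> 0" using u by auto
  have le: "degree u + d \<le> n" if "coeff H d \<noteq> 0" "degree (u * H) \<le> n" for H
  proof -
    have "H \<noteq> 0" using that by auto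
    thus ?thesis using that \<open>u \<noteq> 0\<close> le_degree[of H d] by (simp add: degree_mult_eq)
  qed
  have "coeff F1 d \<noteq> 0 \<or> coeff G1 d \<noteq> 0"
  proof (rule ccontr)
    assume "\<not> ?thesis"
    hence "coeff (smult D F) d = 0" "coeff (smult D G) d = 0" by (simp_all add: FG)
    thus False using P1_endomorphism_top_coeff[OF assms(3)] D by simp
  qed
  moreover have "degree F2 \<le> n" "degree G2 \<le> n"
    by (simp_all add: F2_def G2_def degree_form_subst_linear)
  ultimately have "degree u + d \<le> n" using le[of F1] le[of G1] u by auto
  thus ?thesis using that \<open>u \<noteq> 0\<close> u by (simp add: F1_def G1_def F2_def G2_def)
qed

text \<open>
  In homogeneous coordinates, conjugate endomorphisms satisfy \<open>\<Psi>(Av) = u A\<Phi>(v)\<close> with a constant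
  \<open>u\<close>: both sides have the same degree, because conjugation by the inverse gives the reverse of
  the inequality of degrees.
\<close>

lemma Conj_set_forms:
  fixes F G F' G' :: "'a :: field poly"
  assumes "moebius a b c e \<in> Conj_set (Fract F G) (Fract F' G')" "a * e - b * c \<noteq> 0"
    and "P1_endomorphism d F G" "P1_endomorphism n F' G'" "d \<ge> 1" "n \<ge> 1"
  obtains u where "d = n" "u \<noteq> 0"
    "form_subst d F' [:b, a:] [:e, c:] = smult u (smult a F + smult b G)"
    "form_subst d G' [:b, a:] [:e, c:] = smult u (smult c F + smult e G)"
proof -
  note nc = P1_endomorphism_nonconstant[OF assms(3,5)] P1_endomorphism_nonconstant[OF assms(4,6)]
  have le: "degree F \<le> d" "degree G \<le> d" "degree F' \<le> n" "degree G' \<le> n"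
    using assms unfolding P1_endomorphism_def by auto
  from assms(1) have "conj_equation n F G F' G' a b c e"
    by (subst (asm) moebius_in_Conj_set_iff) (use assms nc le in auto)
  then obtain u where u: "u \<noteq> 0"
      "form_subst n F' [:b, a:] [:e, c:] = u * (smult a F + smult b G)"
      "form_subst n G' [:b, a:] [:e, c:] = u * (smult c F + smult e G)"
      "degree u + d \<le> n"
    by (rule conj_equation_factor) (use assms in auto)
  obtain a' b' c' e' where inv: "PGL2_inv (moebius a b c e) = moebius a' b' c' e'" "a' * e' - b' * c' \<noteq> 0"
    using PGL2_inv(1)[OF moebius_in_PGL2[OF assms(2)]] by (rule PGL2E)
  have "moebius a' b' c' e' \<in> Conj_set (Fract F' G') (Fract F G)"
    using Conj_set_inv[OF assms(1)] nc by (simp add: inv)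
  hence "conj_equation d F' G' F G a' b' c' e'"
    by (subst (asm) moebius_in_Conj_set_iff) (use inv nc le in auto)
  then obtain v :: "'a poly" where "degree v + n \<le> d"
    by (rule conj_equation_factor[OF _ inv(2) assms(4,3,5)])
  with u(4) have "d = n" "degree u = 0" by auto
  from \<open>degree u = 0\<close> obtain t where "u = [:t:]" by (rule degree_eq_zeroE)
  thus ?thesis using that[of t] u \<open>d = n\<close> by simp
qed

section \<open>Good reduction of the conjugating maps\<close>

lemma absval_of_valring_le_1: "absval (of_valring x) \<le> 1"
  using of_valring[of x] by simp

lemma ex_of_valring: "absval x \<le> 1 \<Longrightarrow> \<exists>t. x = of_valring t"
  by (metis Abs_valring_inverse mem_Collect_eq)

lemma absval_inverse: "absval (inverse x) = inverse (absval (x :: 'k :: nonarchimedean_field))"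
proof (cases "x = 0")
  case False
  have "absval x * absval (inverse x) = 1" using False by (simp flip: absval_mult)
  thus ?thesis by (rule inverse_unique[symmetric])
qed simp

lemma absval_divide: "absval (x / y) = absval x / absval (y :: 'k :: nonarchimedean_field)"
  by (simp add: divide_inverse absval_mult absval_inverse)

lemma absval_power: "absval (x ^ n) = absval (x :: 'k :: nonarchimedean_field) ^ n"
  by (induction n) (simp_all add: absval_mult)

definition max_norm :: "'k :: nonarchimedean_field \<Rightarrow> 'k \<Rightarrow> real" where
  "max_norm x y = max (absval x) (absval y)"

lemma max_norm_smult: "max_norm (t * x) (t * y) = absval t * max_norm x y"
  by (simp add: max_norm_def absval_mult max_mult_distrib_left absval_nonneg)

lemma max_norm_linear_le:
  assumes "absval a \<le> 1" "absval b \<le> 1" "absval c \<le> 1" "absval e \<le> 1"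
  shows "max_norm (a * x + b * y) (c * x + e * y) \<le> max_norm x y"
proof -
  have 1: "absval (s * z) \<le> absval z" if "absval s \<le> 1" for s z :: 'a
    using mult_right_mono[OF that absval_nonneg[of z]] by (simp add: absval_mult)
  have "absval (s * x + t * y) \<le> max_norm x y" if "absval s \<le> 1" "absval t \<le> 1" for s t
    using absval_ultrametric[of "s * x" "t * y"] 1[OF that(1), of x] 1[OF that(2), of y]
    by (simp add: max_norm_def)
  thus ?thesis using assms by (simp add: max_norm_def[of "a * x + b * y"])
qed

text \<open>Apply the previous bound to the adjugate matrix.\<close>

lemma max_norm_linear_ge:
  assumes "absval a \<le> 1" "absval b \<le> 1" "absval c \<le> 1" "absval e \<le> 1"
  shows "absval (a * e - b * c) * max_norm x y \<le> max_norm (a * x + b * y) (c * x + e * y)"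
proof -
  let ?X = "a * x + b * y" and ?Y = "c * x + e * y"
  have "max_norm (e * ?X + (- b) * ?Y) ((- c) * ?X + a * ?Y) \<le> max_norm ?X ?Y"
    using assms by (intro max_norm_linear_le) simp_all
  moreover have "e * ?X + (- b) * ?Y = (a * e - b * c) * x" "(- c) * ?X + a * ?Y = (a * e - b * c) * y"
    by (simp_all add: algebra_simps)
  ultimately show ?thesis by (simp only: max_norm_smult)
qed

text \<open>By the ultrametric inequality \<open>f\<close> and \<open>g\<close> cannot both lie in the maximal ideal.\<close>

lemma max_norm_unimodular:
  fixes f g p q :: "'k :: nonarchimedean_field valring"
  assumes "p * f + q * g = 1"
  shows "max_norm (of_valring f) (of_valring g) = 1"
proof (rule antisym)
  show "max_norm (of_valring f) (of_valring g) \<le> 1"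
    by (simp add: max_norm_def absval_of_valring_le_1)
  have "max_norm (of_valring p * of_valring f + of_valring q * of_valring g) (0 * of_valring f + 0 * of_valring g)
          \<le> max_norm (of_valring f) (of_valring g)"
    by (rule max_norm_linear_le) (simp_all add: absval_of_valring_le_1)
  moreover have "of_valring p * of_valring f + of_valring q * of_valring g = 1"
    using arg_cong[OF assms, of of_valring] by simp
  ultimately show "1 \<le> max_norm (of_valring f) (of_valring g)"
    by (simp add: max_norm_def)
qed

text \<open>
  A morphism over the valuation ring multiplies lengths exactly by a power: after scaling, a point
  lies in one of the two integral charts, where the two forms generate the unit ideal.
\<close>

lemma max_norm_P1_endomorphism:
  fixes F G :: "'k :: nonarchimedean_field valring poly"
  assumes "P1_endomorphism d F G" "d \<ge> 1"
  shows "max_norm (form_eval d (map_poly of_valring F) x y) (form_eval d (map_poly of_valring G) x y) =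
           max_norm x y ^ d"
proof -
  define \<Phi> where "\<Phi> x y = max_norm (form_eval d (map_poly of_valring F) x y)
                            (form_eval d (map_poly of_valring G) x y)" for x y
  have scale: "\<Phi> (s * x) (s * y) = absval s ^ d * \<Phi> x y" for s x y
    by (simp add: \<Phi>_def form_eval_scale max_norm_smult absval_power)
  have chart: "\<Phi> t 1 = 1" "\<Phi> 1 t = 1" if "absval t \<le> 1" for t
  proof -
    from ex_of_valring[OF that] obtain \<tau> where t: "t = of_valring \<tau>" ..
    have *: "form_eval d (map_poly of_valring H) t 1 = of_valring (form_eval d H \<tau> 1)"
      "form_eval d (map_poly of_valring H) 1 t = of_valring (form_eval d H 1 \<tau>)" for H
      by (simp_all add: of_valring.form_eval_hom t)
    from assms(1) show "\<Phi> t 1 = 1" "\<Phi> 1 t = 1"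
      unfolding \<Phi>_def * by (metis P1_endomorphismE max_norm_unimodular)+
  qed
  consider "x = 0" "y = 0" | "y \<noteq> 0" "absval x \<le> absval y" | "x \<noteq> 0" "absval y \<le> absval x"
    by (metis absval_0 absval_nonneg linear)
  thus ?thesis
  proof cases
    case 1
    thus ?thesis using assms(2) by (simp add: max_norm_def form_eval_y_0 power_0_left)
  next
    case 2
    hence "absval (x / y) \<le> 1" using absval_eq_0_iff[of y] absval_nonneg[of y]
      by (simp add: absval_divide divide_le_eq)
    with scale[of y "x / y" 1] 2 show ?thesis unfolding \<Phi>_def[symmetric] by (simp add: chart max_norm_def)
  next
    case 3
    hence "absval (y / x) \<le> 1" using absval_eq_0_iff[of x] absval_nonneg[of x]
      by (simp add: absval_divide divide_le_eq)
    with scale[of x 1 "y / x"] 3 show ?thesis unfolding \<Phi>_def[symmetric] by (simp add: chart max_norm_def)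
  qed
qed

lemma PGL2_primitive_matrix:
  fixes f :: "'k :: nonarchimedean_field poly fract"
  assumes "f \<in> PGL2"
  obtains a b c e where "f = moebius (of_valring a) (of_valring b) (of_valring c) (of_valring e)"
    "of_valring a * of_valring e - of_valring b * of_valring c \<noteq> 0"
    "max (max_norm (of_valring a) (of_valring c)) (max_norm (of_valring b) (of_valring e)) = 1"
proof -
  obtain a b c e where f: "f = moebius a b c e" and det: "a * e - b * c \<noteq> 0"
    using assms by (rule PGL2E)
  define M where "M = max (max_norm a c) (max_norm b e)"
  have "M = absval a \<or> M = absval b \<or> M = absval c \<or> M = absval e"
    by (auto simp: M_def max_norm_def max_def)
  then obtain m :: 'k where m: "absval m = M" by metis
  have "m \<noteq> 0"
  proof
    assume "m = 0"
    hence "absval a \<le> 0" "absval b \<le> 0" using m by (auto simp: M_def max_norm_def)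
    hence "a = 0" "b = 0" using absval_nonneg[of a] absval_nonneg[of b]
      by (simp_all add: absval_eq_0_iff[symmetric])
    thus False using det by simp
  qed
  \<comment> \<open>divide by an entry of largest absolute value\<close>
  define s where "s = inverse m"
  have s: "s \<noteq> 0" "absval s * M = 1" using \<open>m \<noteq> 0\<close> m absval_eq_0_iff[of m]
    by (simp_all add: s_def absval_inverse)
  have max1: "max (max_norm (s * a) (s * c)) (max_norm (s * b) (s * e)) = 1"
    using s(2) by (simp add: max_norm_smult M_def max_mult_distrib_left absval_nonneg)
  hence "absval (s * a) \<le> 1" "absval (s * b) \<le> 1" "absval (s * c) \<le> 1" "absval (s * e) \<le> 1"
    by (auto simp: max_norm_def)
  then obtain a' b' c' e' where *: "s * a = of_valring a'" "s * b = of_valring b'"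
      "s * c = of_valring c'" "s * e = of_valring e'" by (meson ex_of_valring)
  have "f = moebius (s * a) (s * b) (s * c) (s * e)"
    unfolding f by (rule moebius_scale[OF s(1), symmetric])
  moreover have "(s * a) * (s * e) - (s * b) * (s * c) = s * s * (a * e - b * c)"
    by (simp add: algebra_simps)
  hence "(s * a) * (s * e) - (s * b) * (s * c) \<noteq> 0" using s(1) det by simp
  ultimately show ?thesis using that max1 unfolding * by blast
qed

text \<open>
  Let \<open>A\<close> be a primitive integral matrix and \<open>\<delta> = |det A|\<close>. Evaluate \<open>|\<Psi>(Av)| = |u| |A\<Phi>(v)|\<close> at
  unit vectors \<open>v\<close>: one that \<open>A\<close> does not shrink gives \<open>1 \<le> |u|\<close>, and a column of the adjugate
  matrix, which \<open>A\<close> shrinks by the factor \<open>\<delta>\<close>, gives \<open>\<delta>\<^sup>d \<ge> |u| \<delta>\<close>. As \<open>d \<ge> 2\<close>, this forces \<open>\<delta> = 1\<close>.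
\<close>

lemma absval_det_conjugating_matrix:
  fixes F G F' G' :: "'k :: nonarchimedean_field valring poly"
  assumes P1: "P1_endomorphism d F G" "P1_endomorphism d F' G'" and "d \<ge> 2"
    and entries: "absval a \<le> 1" "absval b \<le> 1" "absval c \<le> 1" "absval e \<le> 1"
    and primitive: "max (max_norm a c) (max_norm b e) = 1" and det: "a * e - b * c \<noteq> 0"
    and F': "\<And>x y. form_eval d (map_poly of_valring F') (a * x + b * y) (c * x + e * y) =
      u * (a * form_eval d (map_poly of_valring F) x y + b * form_eval d (map_poly of_valring G) x y)"
    and G': "\<And>x y. form_eval d (map_poly of_valring G') (a * x + b * y) (c * x + e * y) =
      u * (c * form_eval d (map_poly of_valring F) x y + e * form_eval d (map_poly of_valring G) x y)"
  shows "absval (a * e - b * c) = 1"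
proof -
  define \<delta> where "\<delta> = absval (a * e - b * c)"
  define \<Phi> where "\<Phi> = (\<lambda>x y. form_eval d (map_poly of_valring F) x y)"
  define \<Phi>' where "\<Phi>' = (\<lambda>x y. form_eval d (map_poly of_valring G) x y)"
  have d: "d \<ge> 1" using \<open>d \<ge> 2\<close> by simp
  have \<Phi>: "max_norm (\<Phi> x y) (\<Phi>' x y) = max_norm x y ^ d" for x y
    unfolding \<Phi>_def \<Phi>'_def by (rule max_norm_P1_endomorphism[OF P1(1) d])
  have eq: "max_norm (a * x + b * y) (c * x + e * y) ^ d =
      absval u * max_norm (a * \<Phi> x y + b * \<Phi>' x y) (c * \<Phi> x y + e * \<Phi>' x y)" for x y
    unfolding max_norm_P1_endomorphism[OF P1(2) d, symmetric] F' G' max_norm_smult \<Phi>_def \<Phi>'_def ..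
  have \<delta>_le: "\<delta> \<le> 1"
    using max_norm_linear_ge[OF entries, of 1 0] primitive
    unfolding \<delta>_def by (simp add: max_norm_def[of 1 0])
  have \<delta>_pos: "\<delta> > 0"
    using det absval_nonneg[of "a * e - b * c"] absval_eq_0_iff[of "a * e - b * c"]
    by (simp add: \<delta>_def less_le)
  \<comment> \<open>a standard basis vector picking out a column of \<open>A\<close> of norm 1\<close>
  obtain x y where v: "max_norm x y = 1" "max_norm (a * x + b * y) (c * x + e * y) = 1"
  proof (cases "max_norm a c = 1")
    case True
    thus ?thesis using that[of 1 0] by (simp add: max_norm_def)
  next
    case False
    hence "max_norm b e = 1" using primitive by (auto simp: max_def split: if_splits)
    thus ?thesis using that[of 0 1] by (simp add: max_norm_def)
  qed
  have "1 = absval u * max_norm (a * \<Phi> x y + b * \<Phi>' x y) (c * \<Phi> x y + e * \<Phi>' x y)"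
    using eq[of x y] v by simp
  also have "\<dots> \<le> absval u * 1"
    using max_norm_linear_le[OF entries, of "\<Phi> x y" "\<Phi>' x y"] v
    by (intro mult_left_mono) (simp_all add: \<Phi> absval_nonneg)
  finally have u: "1 \<le> absval u" by simp
  \<comment> \<open>a column of the adjugate matrix\<close>
  obtain x y where w: "max_norm x y = 1" "max_norm (a * x + b * y) (c * x + e * y) = \<delta>"
  proof (cases "max_norm e c = 1")
    case True
    have "a * e + b * - c = a * e - b * c" "c * e + e * - c = 0" by (simp_all add: algebra_simps)
    thus ?thesis using True that[of e "- c"] absval_nonneg[of "a * e - b * c"]
      by (simp add: max_norm_def \<delta>_def)
  next
    case False
    hence "max_norm b a = 1" using primitive by (auto simp: max_norm_def max_def split: if_splits)
    moreover have "a * - b + b * a = 0" "c * - b + e * a = a * e - b * c"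
      by (simp_all add: algebra_simps)
    ultimately show ?thesis using that[of "- b" a] absval_nonneg[of "a * e - b * c"]
      by (simp only: \<delta>_def max_norm_def absval_0 absval_minus max_absorb2)
  qed
  have "absval u * (\<delta> * 1) \<le> absval u * max_norm (a * \<Phi> x y + b * \<Phi>' x y) (c * \<Phi> x y + e * \<Phi>' x y)"
    using max_norm_linear_ge[OF entries, of "\<Phi> x y" "\<Phi>' x y"] w
    by (intro mult_left_mono) (simp_all add: \<Phi> absval_nonneg \<delta>_def)
  also have "\<dots> = \<delta> ^ d" using eq[of x y] w by simp
  also have "\<dots> \<le> \<delta> ^ 2"
    using \<open>d \<ge> 2\<close> \<delta>_le \<delta>_pos by (intro power_decreasing) simp_all
  finally have "absval u \<le> \<delta>" using \<delta>_pos by (simp add: power2_eq_square)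
  thus ?thesis using u \<delta>_le by (simp add: \<delta>_def)
qed

text \<open>The adjugate matrix supplies the Bezout coefficients on both charts.\<close>

lemma is_model_moebius:
  fixes a b c e :: "'k :: nonarchimedean_field valring"
  assumes "absval (of_valring (a * e - b * c)) = 1"
  shows "is_model 1 [:b, a:] [:e, c:] (moebius (of_valring a) (of_valring b) (of_valring c) (of_valring e))"
proof -
  define D where "D = a * e - b * c"
  obtain \<delta> where \<delta>: "\<delta> * D = 1"
  proof -
    have "absval (inverse (of_valring D)) \<le> 1" using assms by (simp add: absval_inverse D_def)
    then obtain \<delta> where "inverse (of_valring D) = of_valring \<delta>" using ex_of_valring by blast
    moreover have "of_valring D \<noteq> 0" using assms by (auto simp: D_def)
    ultimately have "of_valring (\<delta> * D) = of_valring 1" by (simp flip: \<open>_ = of_valring \<delta>\<close>)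
    hence "\<delta> * D = 1" by (simp only: of_valring_inject)
    thus ?thesis by (rule that)
  qed
  have "[:- (\<delta> * c):] * [:b, a:] + [:\<delta> * a:] * [:e, c:] = [:\<delta> * D:]"
    by (simp add: D_def algebra_simps)
  hence 1: "[:- (\<delta> * c):] * [:b, a:] + [:\<delta> * a:] * [:e, c:] = 1" by (simp add: \<delta> one_pCons)
  have chart: "at_infinity_chart 1 [:x, y:] = [:y, x:]" for x y :: "'k valring"
    by (simp add: at_infinity_chart_def monom_0 monom_Suc)
  have "[:\<delta> * e:] * [:a, b:] + [:- (\<delta> * b):] * [:c, e:] = [:\<delta> * D:]"
    by (simp add: D_def algebra_simps)
  hence 2: "[:\<delta> * e:] * [:a, b:] + [:- (\<delta> * b):] * [:c, e:] = 1" by (simp add: \<delta> one_pCons)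
  have "P1_endomorphism 1 [:b, a:] [:e, c:]"
    unfolding P1_endomorphism_def chart by (intro conjI exI, simp, simp, rule 1, rule 2)
  moreover have "[:of_valring e, of_valring c:] \<noteq> 0"
    using assms by (auto simp: of_valring.hom_diff)
  ultimately show ?thesis by (simp add: is_model_def of_valring.map_poly_pCons)
qed

lemma is_modelD:
  assumes "is_model d F G \<phi>"
  shows "P1_endomorphism d F G" "map_poly of_valring G \<noteq> 0"
    "\<phi> = Fract (map_poly of_valring F) (map_poly of_valring G)" "rat_degree \<phi> = d"
  using assms rat_degree_P1_endomorphism[OF of_valring.P1_endomorphism_hom[of d F G]]
  by (auto simp: is_model_def)

text \<open>
  Since \<open>A\<close> has entries in the valuation ring, the conjugation equation descends to the valuation
  ring as well, from where it can be reduced.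
\<close>

lemma Conj_set_integral_matrix:
  fixes \<phi> \<psi> :: "'k :: nonarchimedean_field poly fract"
  assumes "is_model d F G \<phi>" "is_model n F' G' \<psi>" "d \<ge> 2" "n \<ge> 2" "f \<in> Conj_set \<phi> \<psi>"
  obtains a b c e where "d = n"
    "f = moebius (of_valring a) (of_valring b) (of_valring c) (of_valring e)"
    "absval (of_valring (a * e - b * c)) = 1"
    "conj_equation d F G F' G' a b c e"
proof -
  have "f \<in> PGL2" using assms(5) by (simp add: Conj_set_def)
  then obtain a b c e where f: "f = moebius (of_valring a) (of_valring b) (of_valring c) (of_valring e)"
    and det: "of_valring a * of_valring e - of_valring b * of_valring c \<noteq> 0"
    and primitive: "max (max_norm (of_valring a) (of_valring c)) (max_norm (of_valring b) (of_valring e)) = 1"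
    by (rule PGL2_primitive_matrix)
  note M = is_modelD[OF assms(1)] and M' = is_modelD[OF assms(2)]
  note P = of_valring.P1_endomorphism_hom[OF M(1)] and P' = of_valring.P1_endomorphism_hom[OF M'(1)]
  have f': "moebius (of_valring a) (of_valring b) (of_valring c) (of_valring e) \<in>
      Conj_set (Fract (map_poly of_valring F) (map_poly of_valring G))
               (Fract (map_poly of_valring F') (map_poly of_valring G'))"
    using assms(5) f M(3) M'(3) by simp
  obtain u where u: "d = n"
    "form_subst d (map_poly of_valring F') [:of_valring b, of_valring a:] [:of_valring e, of_valring c:] =
       smult u (smult (of_valring a) (map_poly of_valring F) + smult (of_valring b) (map_poly of_valring G))"
    "form_subst d (map_poly of_valring G') [:of_valring b, of_valring a:] [:of_valring e, of_valring c:] =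
       smult u (smult (of_valring c) (map_poly of_valring F) + smult (of_valring e) (map_poly of_valring G))"
    by (rule Conj_set_forms[OF f' det P P']) (use assms in auto)
  have deg: "degree (map_poly of_valring F') \<le> d" "degree (map_poly of_valring G') \<le> d"
    using P' u(1) by (auto simp: P1_endomorphism_def)
  have "absval (of_valring a * of_valring e - of_valring b * of_valring c) = 1"
    by (rule absval_det_conjugating_matrix[where u = u,
          OF M(1) M'(1)[folded u(1)] assms(3) _ _ _ _ primitive det])
      (simp_all add: absval_of_valring_le_1 u(2,3) form_eval_smult form_eval_add
        flip: form_eval_linear_subst[OF deg(1)] form_eval_linear_subst[OF deg(2)])
  hence "absval (of_valring (a * e - b * c)) = 1" by (simp add: of_valring.hom_diff)
  moreover have "conj_equation d F G F' G' a b c e"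
    using f' deg M'(2) P1_endomorphism_nonconstant(2)[OF P] assms(3)
    by (subst (asm) moebius_in_Conj_set_iff[OF det])
      (simp_all add: of_valring.conj_equation_hom_iff[OF inj_of_valring])
  ultimately show ?thesis using that u(1) f by blast
qed

section \<open>Reduction of the conjugating maps\<close>

lemma reduction_is_model:
  assumes "is_model d F G \<phi>" "d \<ge> 1"
  shows "reduction \<phi> = Fract (map_poly residue F) (map_poly residue G)"
    and "map_poly residue G \<noteq> 0"
    and "P1_endomorphism d (map_poly residue F) (map_poly residue G)"
proof -
  show P: "P1_endomorphism d (map_poly residue F) (map_poly residue G)"
    by (rule residue.P1_endomorphism_hom[OF is_modelD(1)[OF assms(1)]])
  show "map_poly residue G \<noteq> 0" by (rule P1_endomorphism_nonconstant(1)[OF P assms(2)])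
  with assms(1) show "reduction \<phi> = Fract (map_poly residue F) (map_poly residue G)"
    by (rule reduction_eq)
qed

lemma residue_nonzero: "absval (of_valring x) = 1 \<Longrightarrow> residue x \<noteq> 0"
  by (simp add: residue_eq_0_iff)

lemma reduction_moebius:
  fixes a b c e :: "'k :: nonarchimedean_field valring"
  assumes "absval (of_valring (a * e - b * c)) = 1"
  shows "reduction (moebius (of_valring a) (of_valring b) (of_valring c) (of_valring e)) =
           moebius (residue a) (residue b) (residue c) (residue e)"
  using reduction_is_model(1)[OF is_model_moebius[OF assms]] by (simp add: residue.map_poly_pCons)

lemma reduction_in_Conj_set:
  fixes \<phi> \<psi> :: "'k :: nonarchimedean_field poly fract"
  assumes "is_model d F G \<phi>" "is_model n F' G' \<psi>" "d \<ge> 2" "n \<ge> 2" "f \<in> Conj_set \<phi> \<psi>"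
  shows "reduction f \<in> Conj_set (reduction \<phi>) (reduction \<psi>)"
proof -
  obtain a b c e where f: "d = n"
    "f = moebius (of_valring a) (of_valring b) (of_valring c) (of_valring e)"
    "absval (of_valring (a * e - b * c)) = 1" "conj_equation d F G F' G' a b c e"
    using assms by (rule Conj_set_integral_matrix)
  have d: "d \<ge> 1" "n \<ge> 1" using assms by auto
  note R = reduction_is_model[OF assms(1) d(1)] and R' = reduction_is_model[OF assms(2) d(2)]
  have "residue a * residue e - residue b * residue c \<noteq> 0"
    using residue_nonzero[OF f(3)] by (simp add: residue.hom_diff)
  thus ?thesis
    unfolding R(1) R'(1) f(2) reduction_moebius[OF f(3)]
    using residue.conj_equation_hom[OF f(4)] P1_endomorphism_nonconstant(2)[OF R(3) d(1)] R'(2,3) f(1)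
    by (subst moebius_in_Conj_set_iff[of _ _ _ _ _ _ _ d]) (simp_all add: P1_endomorphism_def)
qed

section \<open>Powers of a matrix\<close>

text \<open>
  The Lucas sequence of a matrix \<open>A\<close> with trace \<open>t\<close> and determinant \<open>D\<close> is \<open>(\<lambda>\<^sup>n - \<mu>\<^sup>n)/(\<lambda> - \<mu>)\<close> in terms of
  the eigenvalues; by Cayley-Hamilton, \<open>A\<close> to the power \<open>n + 1\<close> is \<open>s\<^sub>n\<^sub>+\<^sub>1 A - D s\<^sub>n\<close>.
\<close>

fun lucas_seq :: "'a :: comm_ring_1 \<Rightarrow> 'a \<Rightarrow> nat \<Rightarrow> 'a" where
  "lucas_seq t D 0 = 0"
| "lucas_seq t D (Suc 0) = 1"
| "lucas_seq t D (Suc (Suc n)) = t * lucas_seq t D (Suc n) - D * lucas_seq t D n"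

lemma (in coeff_hom) lucas_seq_hom: "h (lucas_seq t D n) = lucas_seq (h t) (h D) n"
  by (induction t D n rule: lucas_seq.induct) (simp_all add: hom_0 hom_1 hom_diff hom_mult)

lemma lucas_seq_eigenvalues:
  fixes l m :: "'a :: comm_ring_1"
  shows "(l - m) * lucas_seq (l + m) (l * m) n = l ^ n - m ^ n"
proof (induction "l + m" "l * m" n rule: lucas_seq.induct)
  case (3 n)
  have "(l - m) * lucas_seq (l + m) (l * m) (Suc (Suc n)) =
        (l + m) * ((l - m) * lucas_seq (l + m) (l * m) (Suc n)) -
        l * m * ((l - m) * lucas_seq (l + m) (l * m) n)" by (simp add: algebra_simps)
  also have "\<dots> = l ^ Suc (Suc n) - m ^ Suc (Suc n)"
    unfolding 3 by (simp add: algebra_simps)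
  finally show ?case .
qed simp_all

lemma lucas_seq_double_eigenvalue:
  fixes r :: "'a :: comm_ring_1"
  shows "lucas_seq (r + r) (r * r) n * r = of_nat n * r ^ n"
proof (induction "r + r" "r * r" n rule: lucas_seq.induct)
  case (3 n)
  have "lucas_seq (r + r) (r * r) (Suc (Suc n)) * r =
        (r + r) * (lucas_seq (r + r) (r * r) (Suc n) * r) - r * r * (lucas_seq (r + r) (r * r) n * r)"
    by (simp add: algebra_simps)
  also have "\<dots> = of_nat (Suc (Suc n)) * r ^ Suc (Suc n)"
    unfolding 3 by (simp add: algebra_simps)
  finally show ?case .
qed simp_all

section \<open>Endomorphisms commuting with a matrix\<close>

lemma eigenvector_exists:
  fixes a b c e l :: "'a :: field"
  assumes "(a - l) * (e - l) = b * c"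
  obtains x y where "x \<noteq> 0 \<or> y \<noteq> 0" "a * x + b * y = l * x" "c * x + e * y = l * y"
proof -
  consider "b \<noteq> 0 \<or> a \<noteq> l" | "b = 0" "a = l" "c \<noteq> 0 \<or> e \<noteq> l" | "b = 0" "a = l" "c = 0" "e = l"
    by blast
  thus ?thesis
  proof cases
    case 1
    have "c * b + e * (l - a) = l * (l - a)" using assms by (simp add: algebra_simps)
    thus ?thesis using 1 by (intro that[of b "l - a"]) (auto simp: algebra_simps)
  next
    case 2
    thus ?thesis by (intro that[of "l - e" c]) (auto simp: algebra_simps)
  next
    case 3
    thus ?thesis by (intro that[of 1 0]) simp_all
  qed
qed

lemma eigenvalue_cases:
  fixes a b c e l m k :: "'a :: field"
  assumes "x \<noteq> 0 \<or> y \<noteq> 0" "a * x + b * y = k * x" "c * x + e * y = k * y"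
    and "a + e = l + m" "a * e - b * c = l * m"
  shows "k = l \<or> k = m"
proof -
  have 1: "(a - k) * x + b * y = 0" "c * x + (e - k) * y = 0"
    using assms(2,3) by (simp_all add: algebra_simps)
  have "((a - k) * (e - k) - b * c) * x = (e - k) * ((a - k) * x + b * y) - b * (c * x + (e - k) * y)"
       "((a - k) * (e - k) - b * c) * y = (a - k) * (c * x + (e - k) * y) - c * ((a - k) * x + b * y)"
    by (simp_all add: algebra_simps)
  hence "(a - k) * (e - k) - b * c = 0" unfolding 1 using assms(1) by auto
  moreover have "(a - k) * (e - k) - b * c = (a * e - b * c) - (a + e) * k + k * k"
    by (simp add: algebra_simps)
  ultimately have "(k - l) * (k - m) = 0"
    unfolding assms(4,5) by (simp add: algebra_simps)
  thus ?thesis by simp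
qed

context
  fixes F G :: "'a :: field poly" and a b c e u :: 'a and d :: nat
  assumes P1: "P1_endomorphism d F G" and d: "d \<ge> 2" and u: "u \<noteq> 0"
    and F: "\<And>x y. form_eval d F (a * x + b * y) (c * x + e * y) =
                u * (a * form_eval d F x y + b * form_eval d G x y)"
    and G: "\<And>x y. form_eval d G (a * x + b * y) (c * x + e * y) =
                u * (c * form_eval d F x y + e * form_eval d G x y)"
begin

text \<open>
  The endomorphism maps an eigenvector of \<open>A\<close> to an eigenvector, since it commutes with \<open>A\<close> up to
  a factor.
\<close>

lemma eigenvalue_power:
  assumes "x \<noteq> 0 \<or> y \<noteq> 0" "a * x + b * y = k * x" "c * x + e * y = k * y"
    and "a + e = l + m" "a * e - b * c = l * m"
  shows "k ^ d = u * l \<or> k ^ d = u * m"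
proof -
  define p where "p = form_eval d F x y"
  define q where "q = form_eval d G x y"
  have "k ^ d * p = u * (a * p + b * q)" "k ^ d * q = u * (c * p + e * q)"
    using F[of x y] G[of x y] unfolding assms(2,3) by (simp_all add: form_eval_scale p_def q_def)
  hence "a * p + b * q = k ^ d / u * p" "c * p + e * q = k ^ d / u * q"
    using u by (simp_all add: field_simps)
  moreover have "p \<noteq> 0 \<or> q \<noteq> 0"
    unfolding p_def q_def by (rule P1_endomorphism_no_common_zero[OF P1 assms(1)])
  ultimately have "k ^ d / u = l \<or> k ^ d / u = m" using assms(4,5) by (rule_tac eigenvalue_cases)
  thus ?thesis using u by (auto simp: divide_eq_eq mult.commute)
qed

text \<open>
  The endomorphism permutes or contracts the two eigenlines, and each of the possibilities
  makes the quotient of the eigenvalues a root of unity.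
\<close>

lemma eigenvalue_quotient_root_of_unity:
  assumes "a + e = l + m" "a * e - b * c = l * m" "l \<noteq> 0" "m \<noteq> 0"
  shows "\<exists>n\<ge>1. l ^ n = m ^ n"
proof -
  have char: "(a - l) * (e - l) = b * c" "(a - m) * (e - m) = b * c"
  proof -
    have "(a - k) * (e - k) - b * c = (a * e - b * c) - (a + e) * k + k * k" for k
      by (simp add: algebra_simps)
    from this[of l] this[of m] show "(a - l) * (e - l) = b * c" "(a - m) * (e - m) = b * c"
      unfolding assms by (simp_all add: algebra_simps)
  qed
  have power: "k ^ d = u * l \<or> k ^ d = u * m" if "(a - k) * (e - k) = b * c" for k
    using that by (rule eigenvector_exists) (rule eigenvalue_power[OF _ _ _ assms(1,2)])
  have "l ^ (d - 1) = m ^ (d - 1)" if "l ^ d = u * l" "m ^ d = u * m"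
  proof -
    obtain j where "d = Suc j" using d by (cases d) auto
    thus ?thesis using that assms by simp
  qed
  moreover have "l ^ Suc d = m ^ Suc d" if "l ^ d = u * m" "m ^ d = u * l"
    using that by simp
  moreover have "d - 1 \<ge> 1" "d \<ge> 1" "Suc d \<ge> 1" using d by simp_all
  ultimately show ?thesis using power[OF char(1)] power[OF char(2)] by metis
qed

text \<open>
  If \<open>A = l + N\<close> with \<open>N \<noteq> 0 = N\<^sup>2\<close>, then \<open>A\<close> translates the affine line \<open>s \<mapsto> w + s Nw\<close> by \<open>1/l\<close>. Along it
  the endomorphism is polynomial of degree \<open>d\<close>, as its top coefficient is the value at \<open>Nw\<close>,
  whereas the values at the multiples of \<open>1/l\<close>, computed from powers of \<open>A\<close>, grow linearly.
\<close>

lemma double_eigenvalue_imp_scalar: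
  assumes "a + e = l + l" "a * e - b * c = l * l" "l \<noteq> 0"
    and char_0: "\<And>n. n > 0 \<Longrightarrow> of_nat n \<noteq> (0 :: 'a)"
  shows "b = 0 \<and> c = 0 \<and> a = e"
proof (rule ccontr)
  assume non_scalar: "\<not> ?thesis"
  define m where "m = a - l"
  have ae: "a = l + m" "e = l - m" using assms(1) by (simp_all add: m_def algebra_simps)
  have nil: "m * m + b * c = 0" using assms(2) by (simp add: ae algebra_simps)
  have "m \<noteq> 0 \<or> b \<noteq> 0 \<or> c \<noteq> 0" using non_scalar ae by auto
  then obtain w1 w2 where w: "m * w1 + b * w2 \<noteq> 0 \<or> c * w1 - m * w2 \<noteq> 0"
    by (metis add.right_neutral add.left_neutral diff_zero mult.right_neutral mult_zero_right)
  define v1 where "v1 = m * w1 + b * w2"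
  define v2 where "v2 = c * w1 - m * w2"
  have Nv: "m * v1 + b * v2 = 0" "c * v1 - m * v2 = 0"
  proof -
    have "m * v1 + b * v2 = (m * m + b * c) * w1" "c * v1 - m * v2 = (m * m + b * c) * w2"
      by (simp_all add: v1_def v2_def algebra_simps)
    thus "m * v1 + b * v2 = 0" "c * v1 - m * v2 = 0" by (simp_all add: nil)
  qed
  have v: "v1 \<noteq> 0 \<or> v2 \<noteq> 0" "a * v1 + b * v2 = l * v1" "c * v1 + e * v2 = l * v2"
    using w[folded v1_def v2_def] Nv by (simp_all add: ae algebra_simps)
  have ld: "l ^ d = u * l" using eigenvalue_power[OF v assms(1,2)] by simp
  define p where "p s = form_eval d F (v1 * s + w1) (v2 * s + w2)" for s
  define q where "q s = form_eval d G (v1 * s + w1) (v2 * s + w2)" for s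
  have step: "l * p (s + 1 / l) = a * p s + b * q s" "l * q (s + 1 / l) = c * p s + e * q s" for s
  proof -
    have "a * (v1 * s + w1) + b * (v2 * s + w2) = (a * v1 + b * v2) * s + (a * w1 + b * w2)"
      by (simp add: algebra_simps)
    also have "\<dots> = l * (v1 * (s + 1 / l) + w1)"
      using assms(3) unfolding v(2) by (simp add: field_simps v1_def ae)
    finally have 1: "a * (v1 * s + w1) + b * (v2 * s + w2) = l * (v1 * (s + 1 / l) + w1)" .
    have "c * (v1 * s + w1) + e * (v2 * s + w2) = (c * v1 + e * v2) * s + (c * w1 + e * w2)"
      by (simp add: algebra_simps)
    also have "\<dots> = l * (v2 * (s + 1 / l) + w2)"
      using assms(3) unfolding v(3) by (simp add: field_simps v2_def ae)
    finally have 2: "c * (v1 * s + w1) + e * (v2 * s + w2) = l * (v2 * (s + 1 / l) + w2)" .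
    have "l ^ d * p (s + 1 / l) = u * (a * p s + b * q s)"
         "l ^ d * q (s + 1 / l) = u * (c * p s + e * q s)"
      using F[of "v1 * s + w1" "v2 * s + w2"] G[of "v1 * s + w1" "v2 * s + w2"]
      unfolding 1 2 form_eval_scale by (simp_all add: p_def q_def)
    thus "l * p (s + 1 / l) = a * p s + b * q s" "l * q (s + 1 / l) = c * p s + e * q s"
      using u by (simp_all add: ld mult.assoc)
  qed
  \<comment> \<open>\<open>(Np, Nq)\<close> is \<open>N\<close> applied to the value \<open>(p 0, q 0)\<close> of the endomorphism at \<open>w\<close>\<close>
  define Np where "Np = m * p 0 + b * q 0"
  define Nq where "Nq = c * p 0 - m * q 0"
  have NN: "m * Np + b * Nq = 0" "c * Np - m * Nq = 0"
  proof -
    have "m * Np + b * Nq = (m * m + b * c) * p 0" "c * Np - m * Nq = (m * m + b * c) * q 0"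
      by (simp_all add: Np_def Nq_def algebra_simps)
    thus "m * Np + b * Nq = 0" "c * Np - m * Nq = 0" by (simp_all add: nil)
  qed
  have lin: "p (of_nat n / l) = p 0 + of_nat n / l * Np \<and> q (of_nat n / l) = q 0 + of_nat n / l * Nq" for n
  proof (induction n)
    case (Suc n)
    have s: "of_nat (Suc n) / l = of_nat n / l + 1 / l" by (simp add: add_divide_distrib)
    define r where "r = of_nat n / l"
    have "l * p (r + 1 / l) = l * (p 0 + (r + 1 / l) * Np) + r * (m * Np + b * Nq)"
      unfolding step using Suc assms(3) by (simp add: r_def[symmetric] ae field_simps) (simp add: Np_def algebra_simps)
    moreover have "l * q (r + 1 / l) = l * (q 0 + (r + 1 / l) * Nq) + r * (c * Np - m * Nq)"
      unfolding step using Suc assms(3) by (simp add: r_def[symmetric] ae field_simps) (simp add: Nq_def algebra_simps)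
    ultimately show ?case unfolding s r_def[symmetric] NN using assms(3) by simp
  qed simp
  have inf: "infinite (range (\<lambda>n. of_nat n / l))"
  proof (rule range_inj_infinite, rule injI)
    have *: "i = j" if "of_nat i = (of_nat j :: 'a)" "i \<le> j" for i j
      using that char_0[of "j - i"] by (cases "i = j") (auto simp: of_nat_diff)
    fix i j assume "of_nat i / l = of_nat j / l"
    hence "of_nat i = (of_nat j :: 'a)" using assms(3) by simp
    thus "i = j" using *[of i j] *[of j i] by (metis linear)
  qed
  have top: "form_eval d H v1 v2 = 0"
    if "\<And>n. form_eval d H (v1 * (of_nat n / l) + w1) (v2 * (of_nat n / l) + w2) = r + of_nat n / l * t"
      and "degree H \<le> d" for H r t
  proof -
    define h where "h = form_subst d H [:w1, v1:] [:w2, v2:]"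
    have "poly h (of_nat n / l) = poly [:r, t:] (of_nat n / l)" for n
      using that(1)[of n] by (simp add: h_def poly_form_subst algebra_simps)
    hence "range (\<lambda>n. of_nat n / l) \<subseteq> {s. poly (h - [:r, t:]) s = 0}" by auto
    hence "h - [:r, t:] = 0" using inf poly_roots_finite finite_subset by metis
    hence "degree h \<le> 1" by simp
    hence "coeff h d = 0" using d by (intro coeff_eq_0) simp
    thus ?thesis
      using form_eval_linear_subst[OF that(2), of w1 v1 w2 v2 1 0] by (simp add: h_def form_eval_y_0)
  qed
  have "form_eval d F v1 v2 = 0"
    by (rule top[of F "p 0" Np]) (use lin P1 in \<open>auto simp: p_def P1_endomorphism_def\<close>)
  moreover have "form_eval d G v1 v2 = 0"
    by (rule top[of G "q 0" Nq]) (use lin P1 in \<open>auto simp: q_def P1_endomorphism_def\<close>)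
  ultimately show False using P1_endomorphism_no_common_zero[OF P1 v(1)] by simp
qed

end

text \<open>
  The eigenvalues exist over the algebraic closure. The conclusion is stated through the Lucas
  sequence, which lies in the field itself and can be reduced.
\<close>

lemma Aut_scalar_or_lucas_seq_zero:
  fixes F G :: "'k :: field poly"
  assumes aut: "moebius a b c e \<in> Aut_set (Fract F G)" and det: "a * e - b * c \<noteq> 0"
    and P1: "P1_endomorphism d F G" and d: "d \<ge> 2"
    and char_0: "\<And>n. n > 0 \<Longrightarrow> of_nat n \<noteq> (0 :: 'k)"
  shows "b = 0 \<and> c = 0 \<and> a = e \<or> (\<exists>n\<ge>1. lucas_seq (a + e) (a * e - b * c) n = 0)"
proof -
  obtain u where u: "u \<noteq> 0"
    "form_subst d F [:b, a:] [:e, c:] = smult u (smult a F + smult b G)"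
    "form_subst d G [:b, a:] [:e, c:] = smult u (smult c F + smult e G)"
    by (rule Conj_set_forms[OF aut[unfolded Aut_set_def] det P1 P1]) (use d in auto)
  define F' where "F' = map_poly to_ac F"
  define G' where "G' = map_poly to_ac G"
  have P1': "P1_endomorphism d F' G'" unfolding F'_def G'_def by (rule to_ac.P1_endomorphism_hom[OF P1])
  hence deg: "degree F' \<le> d" "degree G' \<le> d" by (auto simp: P1_endomorphism_def)
  have "form_subst d F' [:to_ac b, to_ac a:] [:to_ac e, to_ac c:] =
          smult (to_ac u) (smult (to_ac a) F' + smult (to_ac b) G')"
       "form_subst d G' [:to_ac b, to_ac a:] [:to_ac e, to_ac c:] =
          smult (to_ac u) (smult (to_ac c) F' + smult (to_ac e) G')"
    using arg_cong[OF u(2), of "map_poly to_ac"] arg_cong[OF u(3), of "map_poly to_ac"]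
    by (simp_all add: to_ac.form_subst_hom to_ac.map_poly_add to_ac.map_poly_smult
        to_ac.map_poly_pCons F'_def G'_def)
  hence F': "form_eval d F' (to_ac a * x + to_ac b * y) (to_ac c * x + to_ac e * y) =
          to_ac u * (to_ac a * form_eval d F' x y + to_ac b * form_eval d G' x y)"
    and G': "form_eval d G' (to_ac a * x + to_ac b * y) (to_ac c * x + to_ac e * y) =
          to_ac u * (to_ac c * form_eval d F' x y + to_ac e * form_eval d G' x y)" for x y
    by (simp_all add: form_eval_smult form_eval_add
        flip: form_eval_linear_subst[OF deg(1)] form_eval_linear_subst[OF deg(2)])
  define t where "t = to_ac (a + e)"
  define D where "D = to_ac (a * e - b * c)"
  obtain l where l: "poly [:D, - t, 1:] l = 0"
    using alg_closed_imp_poly_has_root[of "[:D, - t, 1:]"] by auto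
  define m where "m = t - l"
  have lm: "to_ac a + to_ac e = l + m" "to_ac a * to_ac e - to_ac b * to_ac c = l * m"
    using l by (simp_all add: m_def t_def D_def algebra_simps add_eq_0_iff2)
  have "D = l * m" using lm(2) by (simp add: D_def)
  moreover have "D \<noteq> 0" using det by (simp add: D_def del: to_ac_diff)
  ultimately have nz: "l \<noteq> 0" "m \<noteq> 0" by auto
  have lucas: "to_ac (lucas_seq (a + e) (a * e - b * c) n) = lucas_seq (l + m) (l * m) n" for n
    using lm by (simp add: to_ac.lucas_seq_hom)
  show ?thesis
  proof (cases "l = m")
    case True
    have "of_nat n \<noteq> (0 :: 'k alg_closure)" if "n > 0" for n
      using char_0[OF that] by (simp flip: to_ac_of_nat)
    hence "to_ac b = 0 \<and> to_ac c = 0 \<and> to_ac a = to_ac e"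
      using double_eigenvalue_imp_scalar[OF P1' d _ F' G', of l] u(1) lm nz True by simp
    thus ?thesis by simp
  next
    case False
    obtain n where "n \<ge> 1" "l ^ n = m ^ n"
      using eigenvalue_quotient_root_of_unity[OF P1' d _ F' G' lm nz] u(1) by auto
    hence "(l - m) * lucas_seq (l + m) (l * m) n = 0"
      by (simp add: lucas_seq_eigenvalues)
    hence "to_ac (lucas_seq (a + e) (a * e - b * c) n) = 0" using False by (simp add: lucas)
    thus ?thesis using \<open>n \<ge> 1\<close> by auto
  qed
qed

section \<open>The group of automorphisms\<close>

definition Aut_group :: "'k :: field poly fract \<Rightarrow> 'k poly fract monoid" where
  "Aut_group \<phi> = \<lparr>carrier = Aut_set \<phi>, monoid.mult = rat_comp, one = fract_z\<rparr>"

lemma Aut_group_simps [simp]: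
  "carrier (Aut_group \<phi>) = Aut_set \<phi>" "monoid.mult (Aut_group \<phi>) = rat_comp"
  "one (Aut_group \<phi>) = fract_z"
  by (simp_all add: Aut_group_def)

lemma Aut_set_PGL2: "f \<in> Aut_set \<phi> \<Longrightarrow> f \<in> PGL2"
  by (simp add: Aut_set_def Conj_set_def)

lemma group_Aut_group:
  assumes "nonconstant \<phi>"
  shows "group (Aut_group \<phi>)"
proof (rule groupI; simp)
  show "fract_z \<in> Aut_set \<phi>"
    using assms by (simp add: Aut_set_def Conj_set_iff z_in_PGL2 rat_comp_z_left rat_comp_z_right)
  fix f assume f: "f \<in> Aut_set \<phi>"
  hence "PGL2_inv f \<in> Aut_set \<phi>" using Conj_set_inv assms unfolding Aut_set_def by blast
  thus "\<exists>g\<in>Aut_set \<phi>. rat_comp g f = fract_z" using PGL2_inv(3)[OF Aut_set_PGL2[OF f]] by blast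
  show "rat_comp fract_z f = f" by (intro rat_comp_z_left PGL2_nonconstant Aut_set_PGL2[OF f])
  fix g assume g: "g \<in> Aut_set \<phi>"
  show "rat_comp f g \<in> Aut_set \<phi>"
    using f g Conj_set_comp assms unfolding Aut_set_def by blast
  fix h assume h: "h \<in> Aut_set \<phi>"
  show "rat_comp (rat_comp f g) h = rat_comp f (rat_comp g h)"
    by (intro rat_comp_assoc PGL2_nonconstant Aut_set_PGL2[OF g] Aut_set_PGL2[OF h])
qed

lemma moebius_power:
  fixes a b c e :: "'k :: field"
  assumes "nonconstant \<phi>" "a * e - b * c \<noteq> 0" "moebius a b c e \<in> Aut_set \<phi>"
  defines "D \<equiv> a * e - b * c"
  defines "s \<equiv> lucas_seq (a + e) D"
  shows "moebius a b c e [^]\<^bsub>Aut_group \<phi>\<^esub> Suc n =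
           moebius (s (Suc n) * a - D * s n) (s (Suc n) * b) (s (Suc n) * c) (s (Suc n) * e - D * s n)
         \<and> (s (Suc n) * a - D * s n) * (s (Suc n) * e - D * s n) - (s (Suc n) * b) * (s (Suc n) * c) \<noteq> 0"
proof (induction n)
  case 0
  interpret G: group "Aut_group \<phi>" by (rule group_Aut_group[OF assms(1)])
  have "moebius a b c e [^]\<^bsub>Aut_group \<phi>\<^esub> Suc 0 = moebius a b c e"
    using G.nat_pow_eone[of "moebius a b c e"] assms(3) by simp
  thus ?case using assms(2) by (simp add: s_def)
next
  case (Suc n)
  let ?a = "s (Suc n) * a - D * s n" and ?b = "s (Suc n) * b"
    and ?c = "s (Suc n) * c" and ?e = "s (Suc n) * e - D * s n"
  have s: "s (Suc (Suc n)) = (a + e) * s (Suc n) - D * s n" by (simp add: s_def)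
  have *: "?a * a + ?b * c = s (Suc (Suc n)) * a - D * s (Suc n)"
    "?a * b + ?b * e = s (Suc (Suc n)) * b"
    "?c * a + ?e * c = s (Suc (Suc n)) * c"
    "?c * b + ?e * e = s (Suc (Suc n)) * e - D * s (Suc n)"
    unfolding s by (simp_all add: D_def algebra_simps)
  have "moebius a b c e [^]\<^bsub>Aut_group \<phi>\<^esub> Suc (Suc n) =
        rat_comp (moebius a b c e [^]\<^bsub>Aut_group \<phi>\<^esub> Suc n) (moebius a b c e)"
    by (simp only: monoid.nat_pow_Suc[OF group.is_monoid[OF group_Aut_group[OF assms(1)]]] Aut_group_simps)
  also have "\<dots> = rat_comp (moebius ?a ?b ?c ?e) (moebius a b c e)" using Suc by simp
  also have "\<dots> = moebius (?a * a + ?b * c) (?a * b + ?b * e) (?c * a + ?e * c) (?c * b + ?e * e)"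
    by (rule rat_comp_moebius) (use Suc assms(2) in auto)
  finally have "moebius a b c e [^]\<^bsub>Aut_group \<phi>\<^esub> Suc (Suc n) = \<dots>" .
  moreover have "(?a * a + ?b * c) * (?c * b + ?e * e) - (?a * b + ?b * e) * (?c * a + ?e * c) \<noteq> 0"
    by (rule det_mult_nonzero) (use Suc assms(2) in auto)
  ultimately show ?case unfolding * by blast
qed

text \<open>
  By Lagrange's theorem the power of \<open>A\<close> at the group order is a scalar matrix, and a power of
  \<open>A\<close> is a combination of \<open>A\<close> and the identity with the Lucas number as coefficient of \<open>A\<close>.
\<close>

lemma Aut_scalar_or_lucas_seq_card_zero:
  fixes a b c e :: "'k :: field"
  assumes "nonconstant \<phi>" "a * e - b * c \<noteq> 0" "moebius a b c e \<in> Aut_set \<phi>"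
    and "card (Aut_set \<phi>) > 0"
  shows "b = 0 \<and> c = 0 \<and> a = e \<or> lucas_seq (a + e) (a * e - b * c) (card (Aut_set \<phi>)) = 0"
proof -
  interpret G: group "Aut_group \<phi>" by (rule group_Aut_group[OF assms(1)])
  define s where "s = lucas_seq (a + e) (a * e - b * c)"
  obtain n where n: "card (Aut_set \<phi>) = Suc n" using assms(4) by (cases "card (Aut_set \<phi>)") auto
  have "moebius a b c e [^]\<^bsub>Aut_group \<phi>\<^esub> Suc n = fract_z"
    using G.pow_order_eq_1[of "moebius a b c e"] assms(3) n by (simp add: Coset.order_def)
  with moebius_power[OF assms(1-3), of n]
  have "moebius (s (Suc n) * a - (a * e - b * c) * s n) (s (Suc n) * b) (s (Suc n) * c)
          (s (Suc n) * e - (a * e - b * c) * s n) = fract_z"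
    and "(s (Suc n) * a - (a * e - b * c) * s n) * (s (Suc n) * e - (a * e - b * c) * s n) -
           (s (Suc n) * b) * (s (Suc n) * c) \<noteq> 0"
    unfolding s_def by auto
  hence "s (Suc n) * b = 0 \<and> s (Suc n) * c = 0 \<and>
         s (Suc n) * a - (a * e - b * c) * s n = s (Suc n) * e - (a * e - b * c) * s n"
    by (subst (asm) moebius_eq_z_iff) (auto simp: moebius_denom_nonzero)
  thus ?thesis by (auto simp: n s_def)
qed

section \<open>Injectivity of reduction\<close>

lemma of_valring_eq_0_iff: "of_valring x = 0 \<longleftrightarrow> x = 0"
  by (metis of_valring_hom(1) of_valring_inject)

lemma is_model_nonconstant:
  assumes "is_model d F G \<phi>" "d \<ge> 1"
  shows "nonconstant \<phi>"
  unfolding is_modelD(3)[OF assms(1)]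
  by (rule P1_endomorphism_nonconstant(2)[OF of_valring.P1_endomorphism_hom[OF is_modelD(1)[OF assms(1)]] assms(2)])

lemma unit_det_nonzero:
  fixes a b c e :: "'k :: nonarchimedean_field valring"
  assumes "absval (of_valring (a * e - b * c)) = 1"
  shows "of_valring a * of_valring e - of_valring b * of_valring c \<noteq> 0"
proof
  assume "of_valring a * of_valring e - of_valring b * of_valring c = 0"
  hence "of_valring (a * e - b * c) = 0" by (simp add: of_valring.hom_diff)
  thus False using assms by simp
qed

text \<open>
  Modulo the maximal ideal the matrix is a scalar \<open>r \<noteq> 0\<close>, so its Lucas sequence reduces to
  \<open>n r\<^sup>n\<^sup>-\<^sup>1\<close>. This vanishes for no \<open>n \<ge> 1\<close> if the residue characteristic is zero, and not at the
  group order if that is prime to the characteristic.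
\<close>

lemma trivial_reduction_imp_trivial:
  fixes a b c e :: "'k :: nonarchimedean_field valring"
  assumes model: "is_model d F G \<phi>" "d \<ge> 2"
    and aut: "moebius (of_valring a) (of_valring b) (of_valring c) (of_valring e) \<in> Aut_set \<phi>"
    and unit: "absval (of_valring (a * e - b * c)) = 1"
    and red: "residue b = 0" "residue c = 0" "residue a = residue e"
    and char: "CHAR('k residue_field) = 0 \<or> coprime (card (Aut_set \<phi>)) CHAR('k residue_field)"
  shows "b = 0 \<and> c = 0 \<and> a = e"
proof -
  define s where "s = lucas_seq (a + e) (a * e - b * c)"
  have det: "of_valring a * of_valring e - of_valring b * of_valring c \<noteq> 0"
    by (rule unit_det_nonzero[OF unit])
  have s: "of_valring (s n) = lucas_seq (of_valring a + of_valring e)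
      (of_valring a * of_valring e - of_valring b * of_valring c) n" for n
    by (simp add: s_def of_valring.lucas_seq_hom of_valring.hom_diff)
  have "residue (a * e - b * c) \<noteq> 0" by (rule residue_nonzero[OF unit])
  hence r: "residue e \<noteq> 0" using red by (simp add: residue.hom_diff)
  have "residue (s n) * residue e = of_nat n * residue e ^ n" for n
    using lucas_seq_double_eigenvalue[of "residue e" n] red
    by (simp add: s_def residue.lucas_seq_hom residue.hom_diff)
  hence s_nz: "s n \<noteq> 0" if "of_nat n \<noteq> (0 :: 'k residue_field)" for n
    using that r by (metis mult_eq_0_iff power_not_zero residue_hom(1))
  note M = is_modelD[OF model(1)]
  note P = of_valring.P1_endomorphism_hom[OF M(1)]
  have inj: "?thesis" if "of_valring b = 0 \<and> of_valring c = 0 \<and> of_valring a = of_valring e"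
    using that by (simp add: of_valring_eq_0_iff of_valring_inject)
  show ?thesis
  proof (cases "CHAR('k residue_field) = 0")
    case True
    hence res: "of_nat n \<noteq> (0 :: 'k residue_field)" if "n > 0" for n
      using that by (simp add: of_nat_eq_0_iff_char_dvd)
    have "of_nat n \<noteq> (0 :: 'k)" if "n > 0" for n
    proof
      assume "of_nat n = (0 :: 'k)"
      hence "of_valring (of_nat n :: 'k valring) = of_valring 0" by (simp add: of_valring.hom_of_nat)
      hence "residue (of_nat n :: 'k valring) = 0" by (simp only: of_valring_inject residue_hom)
      thus False using res[OF that] by (simp add: residue.hom_of_nat)
    qed
    from Aut_scalar_or_lucas_seq_zero[OF aut[unfolded M(3)] det P model(2) this]
    consider "of_valring b = 0 \<and> of_valring c = 0 \<and> of_valring a = of_valring e"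
      | n where "n \<ge> 1" "s n = 0"
      unfolding s[symmetric] of_valring_eq_0_iff by blast
    thus ?thesis
    proof cases
      case 2
      thus ?thesis using s_nz[of n] res[of n] by simp
    qed (rule inj)
  next
    case False
    let ?N = "card (Aut_set \<phi>)"
    have cop: "coprime ?N CHAR('k residue_field)" using char False by simp
    have CHAR: "CHAR('k residue_field) \<noteq> 1" by simp
    have "?N > 0" using cop CHAR by (cases "?N = 0") auto
    moreover have "nonconstant \<phi>" using is_model_nonconstant[OF model(1)] model(2) by simp
    ultimately have *: "of_valring b = 0 \<and> of_valring c = 0 \<and> of_valring a = of_valring e \<or> of_valring (s ?N) = 0"
      using Aut_scalar_or_lucas_seq_card_zero[OF _ det aut] by (simp add: s)
    have "of_nat ?N \<noteq> (0 :: 'k residue_field)"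
    proof
      assume "of_nat ?N = (0 :: 'k residue_field)"
      hence "CHAR('k residue_field) dvd ?N" by (simp add: of_nat_eq_0_iff_char_dvd)
      with cop have "CHAR('k residue_field) dvd 1" by (metis coprime_common_divisor dvd_refl)
      thus False using CHAR by simp
    qed
    from s_nz[OF this] have "of_valring (s ?N) \<noteq> 0" by (simp only: of_valring_eq_0_iff not_False_eq_True)
    thus ?thesis using * inj by blast
  qed
qed

lemma reduction_inj_on_Conj_set:
  fixes \<phi> \<psi> :: "'k :: nonarchimedean_field poly fract"
  assumes model: "is_model d F G \<phi>" "is_model n F' G' \<psi>" "d \<ge> 2" "n \<ge> 2"
    and char: "CHAR('k residue_field) = 0 \<or> coprime (card (Aut_set \<phi>)) CHAR('k residue_field)"
  shows "inj_on reduction (Conj_set \<phi> \<psi>)"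
proof (rule inj_onI)
  fix f g assume f: "f \<in> Conj_set \<phi> \<psi>" and g: "g \<in> Conj_set \<phi> \<psi>" and red: "reduction f = reduction g"
  obtain a b c e where f': "f = moebius (of_valring a) (of_valring b) (of_valring c) (of_valring e)"
    and uf: "absval (of_valring (a * e - b * c)) = 1"
    by (rule Conj_set_integral_matrix[OF model f])
  obtain a' b' c' e' where g': "g = moebius (of_valring a') (of_valring b') (of_valring c') (of_valring e')"
    and ug: "absval (of_valring (a' * e' - b' * c')) = 1"
    by (rule Conj_set_integral_matrix[OF model g])
  have det: "of_valring a * of_valring e - of_valring b * of_valring c \<noteq> 0"
      "of_valring a' * of_valring e' - of_valring b' * of_valring c' \<noteq> 0"
    using uf ug by (auto dest: unit_det_nonzero)
  note adj = moebius_adjugate[OF det(2)]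
  have G: "g \<in> PGL2" using g by (simp add: Conj_set_def)
  define g2 where "g2 = moebius (of_valring e') (- of_valring b') (- of_valring c') (of_valring a')"
  have g2: "g2 \<in> PGL2" using moebius_in_PGL2[OF adj(3)] by (simp add: g2_def)
  note nc = PGL2_nonconstant[OF g2] PGL2_nonconstant[OF G]
  have "g2 = rat_comp g2 (rat_comp g (PGL2_inv g))"
    using PGL2_inv[OF G] by (simp add: rat_comp_z_right)
  also have "\<dots> = rat_comp (rat_comp g2 g) (PGL2_inv g)"
    using PGL2_inv[OF G] nc by (simp add: rat_comp_assoc PGL2_nonconstant)
  also have "rat_comp g2 g = fract_z" using adj(2) by (simp add: g2_def g')
  finally have g2_inv: "g2 = PGL2_inv g"
    using PGL2_inv[OF G] by (simp add: rat_comp_z_left PGL2_nonconstant)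
  define p where "p = e' * a - b' * c"
  define q where "q = e' * b - b' * e"
  define r where "r = a' * c - c' * a"
  define t where "t = a' * e - c' * b"
  define h where "h = rat_comp g2 f"
  have h: "h = moebius (of_valring p) (of_valring q) (of_valring r) (of_valring t)"
    using rat_comp_moebius[OF adj(3) det(1)]
    by (simp add: h_def g2_def f' p_def q_def r_def t_def of_valring.hom_diff)
  have "p * t - q * r = (a' * e' - b' * c') * (a * e - b * c)"
    by (simp add: p_def q_def r_def t_def algebra_simps)
  hence unit: "absval (of_valring (p * t - q * r)) = 1" using uf ug by (simp add: absval_mult)
  have nz: "nonconstant \<phi>" "nonconstant \<psi>"
    using is_model_nonconstant[OF model(1)] is_model_nonconstant[OF model(2)] model(3,4) by auto
  have aut: "h \<in> Aut_set \<phi>"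
    unfolding h_def g2_inv Aut_set_def using Conj_set_comp[OF f Conj_set_inv[OF g nz]] nz by simp
  have rdet: "residue a * residue e - residue b * residue c \<noteq> 0"
      "residue a' * residue e' - residue b' * residue c' \<noteq> 0"
    using residue_nonzero[OF uf] residue_nonzero[OF ug] by (simp_all add: residue.hom_diff)
  note radj = moebius_adjugate[OF rdet(2)]
  have rpt: "residue p * residue t - residue q * residue r \<noteq> 0"
    using residue_nonzero[OF unit] by (simp add: residue.hom_diff)
  have "moebius (residue p) (residue q) (residue r) (residue t) =
        rat_comp (moebius (residue e') (- residue b') (- residue c') (residue a'))
          (moebius (residue a) (residue b) (residue c) (residue e))"
    using rat_comp_moebius[OF radj(3) rdet(1)]
    by (simp add: p_def q_def r_def t_def residue.hom_diff)
  also have "moebius (residue a) (residue b) (residue c) (residue e) =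
             moebius (residue a') (residue b') (residue c') (residue e')"
    using red unfolding f' g' reduction_moebius[OF uf] reduction_moebius[OF ug] .
  also have "rat_comp (moebius (residue e') (- residue b') (- residue c') (residue a')) \<dots> = fract_z"
    by (rule radj(2))
  finally have "residue q = 0 \<and> residue r = 0 \<and> residue p = residue t"
    by (subst (asm) moebius_eq_z_iff) (use moebius_denom_nonzero[OF rpt] in auto)
  hence "q = 0 \<and> r = 0 \<and> p = t"
    using trivial_reduction_imp_trivial[OF model(1,3) aut[unfolded h] unit _ _ _ char] by simp
  hence hz: "h = fract_z"
    unfolding h using unit by (subst moebius_eq_z_iff) auto
  have "f = rat_comp (rat_comp g g2) f"
    using PGL2_inv(2)[OF G] f by (simp add: g2_inv rat_comp_z_left PGL2_nonconstant Conj_set_def)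
  also have "\<dots> = rat_comp g h"
    unfolding h_def using nc f by (simp add: rat_comp_assoc PGL2_nonconstant Conj_set_def)
  also have "\<dots> = g" by (simp add: hz rat_comp_z_right)
  finally show "f = g" .
qed

theorem mainTheorem5:
  fixes \<phi> \<psi> :: "'k :: nonarchimedean_field poly fract"
  assumes "rat_degree \<phi> \<ge> 2" and "rat_degree \<psi> \<ge> 2"
    and "good_reduction \<phi>" and "good_reduction \<psi>"
  shows "(\<forall>f \<in> Conj_set \<phi> \<psi>. good_reduction f) \<and>
         reduction \<in> Conj_set \<phi> \<psi> \<rightarrow> Conj_set (reduction \<phi>) (reduction \<psi>) \<and>
         (CHAR('k residue_field) = 0 \<or> coprime (card (Aut_set \<phi>)) CHAR('k residue_field) \<longrightarrow>
            inj_on reduction (Conj_set \<phi> \<psi>))"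
proof -
  obtain d F G n F' G' where model: "is_model d F G \<phi>" "is_model n F' G' \<psi>"
    using assms(3,4) by (auto simp: good_reduction_def)
  have d: "d \<ge> 2" "n \<ge> 2"
    using assms(1,2) is_modelD(4)[OF model(1)] is_modelD(4)[OF model(2)] by auto
  have "good_reduction f" if "f \<in> Conj_set \<phi> \<psi>" for f
    by (rule Conj_set_integral_matrix[OF model d that])
      (auto simp only: good_reduction_def dest: is_model_moebius)
  thus ?thesis
    using reduction_in_Conj_set[OF model d] reduction_inj_on_Conj_set[OF model d] by auto
qed

end
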